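(* Let $a,b,c,d,t,f\in\mathbb C\setminus\{0\}$, $\sigma\in(0,1)$ with $|a|,|b|,|c|<\sigma$, $|d|<1$, $|t|<\sigma$, $\theta\in[0,\pi]$, $f,fe^{2i\theta}\notin\{q^m:m\in\mathbb Z\}$, $z=e^{i\psi}$, and parameters generic so that no denominator vanishes (e.g. $ad\notin\Omega_q$). Then $$\int_{-\pi}^{\pi}\frac{\big((fe^{i\theta},\tfrac qfe^{-i\theta})\tfrac\sigma z,(fe^{i\theta},\tfrac qfe^{-i\theta},abc)\tfrac z\sigma;q\big)_\infty}{\big(e^{\pm i\theta}\tfrac\sigma z,(a,b,c)\tfrac z\sigma;q\big)_\infty}{}_3\phi_2\!\left(\begin{matrix}d\frac\sigma z,ab,ac\\ abc\frac z\sigma,ad\end{matrix};q,\frac{tz}\sigma\right)d\psi$$ $$=\frac{2\pi\vartheta(f,fe^{2i\theta};q)(ab,ac,bc;q)_\infty}{(q,ae^{\pm i\theta},be^{\pm i\theta},ce^{\pm i\theta};q)_\infty}{}_2\phi_1\!\left(\begin{matrix}ae^{i\theta},de^{i\theta}\\ ad\end{matrix};q,te^{-i\theta}\right){}_2\phi_1\!\left(\begin{matrix}be^{-i\theta},ce^{-i\theta}\\ bc\end{matrix};q,te^{i\theta}\right).$$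
   Context: $q\in\mathbb C$, $0<|q|<1$; $(a;q)_k$, $(a;q)_\infty$ $q$-shifted factorials, several entries mean a product; $((u_1,\dots,u_n)y;q)_\infty=\prod_i(u_iy;q)_\infty$; $e^{\pm i\theta}$ as an entry means both $e^{i\theta}$ and $e^{-i\theta}$. $\Omega_q=\{q^{-k}:k\in\mathbb N_0\}$. $\vartheta(x;q)=(x,q/x;q)_\infty$, $\vartheta(x,y;q)=\vartheta(x;q)\vartheta(y;q)$. ${}_{r+1}\phi_r\!\left(\begin{smallmatrix}a_1,\dots,a_{r+1}\\ b_1,\dots,b_r\end{smallmatrix};q,z\right)=\sum_{k\ge0}\frac{(a_1,\dots,a_{r+1};q)_k}{(q,b_1,\dots,b_r;q)_k}z^k$. *)

theory Defs
  imports "HOL-Analysis.Analysis"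
begin

definition qpoch :: "complex \<Rightarrow> complex \<Rightarrow> nat \<Rightarrow> complex" where
  "qpoch a q n = (\<Prod>k<n. 1 - a * q ^ k)"

definition qpoch_inf :: "complex \<Rightarrow> complex \<Rightarrow> complex" where
  "qpoch_inf a q = (\<Prod>k. 1 - a * q ^ k)"

definition qpochs_inf :: "complex list \<Rightarrow> complex \<Rightarrow> complex" where
  "qpochs_inf as q = prod_list (map (\<lambda>a. qpoch_inf a q) as)"

definition qtheta :: "complex \<Rightarrow> complex \<Rightarrow> complex" where
  "qtheta x q = qpoch_inf x q * qpoch_inf (q / x) q"

text \<open>Basic hypergeometric series r+1 phi r with numerator parameters as
  (length r+1) and denominator parameters bs (length r).\<close>
definition qphi :: "complex list \<Rightarrow> complex list \<Rightarrow> complex \<Rightarrow> complex \<Rightarrow> complex" where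
  "qphi as bs q z = (\<Sum>k. prod_list (map (\<lambda>a. qpoch a q k) as)
      / (qpoch q q k * prod_list (map (\<lambda>b. qpoch b q k) bs)) * z ^ k)"

definition Omega_q :: "complex \<Rightarrow> complex set" where
  "Omega_q q = {inverse (q ^ k) | k. True}"

end

theory Submission
  imports Defs "HOL-Complex_Analysis.Complex_Analysis"
begin

text \<open>
  With \<open>w = z / \<sigma>\<close>, \<open>e = exp (i \<theta>)\<close> and \<open>p = f e\<close> the integral is \<open>L F\<close>, where the functional \<open>L\<close> integrates
  against the kernel \<open>\<vartheta>(p w) \<vartheta>(p / w) / (e / w, 1 / (e w); q)\<close> over a circle \<open>|w| = R > 1\<close>, and \<open>F\<close> is holomorphic
  on a larger disc. The quasi-periodicity of \<open>\<vartheta>\<close> and a contour shift from \<open>R\<close> to \<open>R / q\<close> give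
  \<open>(e + 1 / e) L g = L (w g + (g - g(q w)) / w)\<close>. Hence \<open>L\<close> sends \<open>w ^ n\<close> to the continuous
  \<open>q\<close>-Hermite polynomials, up to the total mass \<open>L 1\<close>, which is computed from a residue.

  The coefficient of \<open>t ^ k\<close> is first treated for \<open>d = 0\<close>: as a function of \<open>a\<close>, both sides then
  satisfy the same recursion from \<open>a\<close> to \<open>a q\<close>, and the limit \<open>a q ^ n \<rightarrow> 0\<close> reduces to fewer parameters.
  A terminating \<open>q\<close>-Chu--Vandermonde sum, used once for the integrand and once for the
  \<open>{}\<^sub>2\<phi>\<^sub>1\<close> factor, passes from \<open>d = 0\<close> to general \<open>d\<close>.
\<close>

subsection \<open>Shifted factorials\<close>

lemma qpoch_0 [simp]: "qpoch a q 0 = 1"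
  by (simp add: qpoch_def)

lemma qpoch_Suc: "qpoch a q (Suc n) = qpoch a q n * (1 - a * q ^ n)"
  by (simp add: qpoch_def)

lemma qpoch_add: "qpoch a q (m + n) = qpoch a q m * qpoch (a * q ^ m) q n"
  by (induction n) (simp_all add: qpoch_Suc power_add mult_ac)

lemma qpoch_Suc_left: "qpoch a q (Suc n) = (1 - a) * qpoch (a * q) q n"
  using qpoch_add[of a q 1 n] by (simp add: qpoch_Suc)

lemma qpoch_zero_left [simp]: "qpoch 0 q n = 1"
  by (simp add: qpoch_def)

lemma qpoch_one_left [simp]: "qpoch 1 q (Suc n) = 0"
  by (simp add: qpoch_Suc_left)

lemma qpoch_nonzero:
  assumes "cmod q < 1" "cmod a < 1"
  shows "qpoch a q n \<noteq> 0"
proof -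
  have "cmod (a * q ^ k) < 1" for k
    using assms mult_left_le[of "cmod q ^ k" "cmod a"]
    by (simp add: norm_mult norm_power power_le_one)
  then have "a * q ^ k \<noteq> 1" for k
    by (metis less_irrefl norm_one)
  then show ?thesis by (simp add: qpoch_def)
qed

lemma qpoch_qq_nonzero: "cmod q < 1 \<Longrightarrow> qpoch q q n \<noteq> 0"
  by (rule qpoch_nonzero)

section \<open>Convergence, zeros and analyticity of the infinite products\<close>

lemma abs_convergent_prod_qpoch:
  fixes q :: complex
  assumes "cmod q < 1"
  shows "abs_convergent_prod (\<lambda>k. 1 - a * q ^ k)"
proof -
  have "summable (\<lambda>k. cmod ((1 - a * q ^ k) - 1))"
    using assms by (simp add: norm_mult norm_power summable_mult summable_geometric)
  then show ?thesis
    by (rule summable_imp_abs_convergent_prod)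
qed

lemma qpoch_tendsto:
  assumes "cmod q < 1"
  shows "(\<lambda>n. qpoch a q n) \<longlonglongrightarrow> qpoch_inf a q"
proof -
  have "convergent_prod (\<lambda>k. 1 - a * q ^ k)"
    using abs_convergent_prod_qpoch[OF assms] by (rule abs_convergent_prod_imp_convergent_prod)
  from convergent_prod_LIMSEQ[OF this] 
  have "(\<lambda>n. qpoch a q (Suc n)) \<longlonglongrightarrow> qpoch_inf a q"
    by (simp add: qpoch_def qpoch_inf_def lessThan_Suc_atMost)
  then show ?thesis by (simp only: filterlim_sequentially_Suc)
qed

lemma qpoch_inf_split:
  assumes "cmod q < 1"
  shows "qpoch_inf a q = qpoch a q n * qpoch_inf (a * q ^ n) q"
proof (rule LIMSEQ_unique)
  show "(\<lambda>k. qpoch a q (k + n)) \<longlonglongrightarrow> qpoch_inf a q"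
    using qpoch_tendsto[OF assms] by (rule LIMSEQ_ignore_initial_segment)
  have "(\<lambda>k. qpoch a q n * qpoch (a * q ^ n) q k) \<longlonglongrightarrow> qpoch a q n * qpoch_inf (a * q ^ n) q"
    by (intro tendsto_intros qpoch_tendsto assms)
  then show "(\<lambda>k. qpoch a q (k + n)) \<longlonglongrightarrow> qpoch a q n * qpoch_inf (a * q ^ n) q"
    by (simp add: qpoch_add[symmetric] add.commute)
qed

lemma qpoch_inf_Suc: 
  assumes "cmod q < 1"
  shows "qpoch_inf a q = (1 - a) * qpoch_inf (a * q) q"
  using qpoch_inf_split[OF assms, of a 1] by (simp add: qpoch_Suc)

lemma qpoch_inf_zero_left [simp]: "qpoch_inf 0 q = 1"
  by (simp add: qpoch_inf_def)

lemma qpoch_inf_nonzero: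
  assumes "cmod q < 1" "cmod a < 1"
  shows "qpoch_inf a q \<noteq> 0"
proof -
  have "1 - a * q ^ k \<noteq> 0" for k
    using qpoch_nonzero[OF assms, of "Suc k"] by (simp add: qpoch_Suc)
  then show ?thesis unfolding qpoch_inf_def
    by (intro prodinf_nonzero abs_convergent_prod_imp_convergent_prod abs_convergent_prod_qpoch assms)
qed

text \<open>The partial products converge locally uniformly, by a Weierstrass test with a geometric
  majorant, so their limit is entire.\<close>

lemma holomorphic_qpoch_inf:
  assumes q: "cmod q < 1"
  shows "(\<lambda>x. qpoch_inf x q) holomorphic_on A"
proof -
  have "(\<lambda>x. qpoch_inf x q) holomorphic_on UNIV"
  proof (rule holomorphic_uniform_sequence[where f = "\<lambda>n x. qpoch x q n"])
    show "(\<lambda>x. qpoch x q n) holomorphic_on UNIV" for n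
      unfolding qpoch_def by (intro holomorphic_intros)
    fix x :: complex
    have "uniformly_convergent_on (cball x 1) (\<lambda>N y. \<Prod>n<N. 1 - y * q ^ n)"
    proof (rule uniformly_convergent_on_prod')
      show "uniformly_convergent_on (cball x 1) (\<lambda>N y. \<Sum>n<N. cmod (1 - y * q ^ n - 1))"
      proof (rule Weierstrass_m_test'[where M = "\<lambda>n. (cmod x + 1) * cmod q ^ n"])
        show "summable (\<lambda>n. (cmod x + 1) * cmod q ^ n)"
          using q by (intro summable_mult summable_geometric) auto
        fix n y assume "y \<in> cball x 1"
        then have "cmod y \<le> cmod x + 1"
          by (metis add.commute dist_commute dist_norm mem_cball norm_triangle_sub add_left_mono order_trans)
        then show "norm (cmod (1 - y * q ^ n - 1)) \<le> (cmod x + 1) * cmod q ^ n"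
          by (simp add: norm_mult norm_power mult_right_mono)
      qed
    qed (auto intro!: continuous_intros)
    then obtain l where l: "uniform_limit (cball x 1) (\<lambda>n y. qpoch y q n) l sequentially"
      by (auto simp: uniformly_convergent_on_def qpoch_def)
    have "l y = qpoch_inf y q" if "y \<in> cball x 1" for y
      using tendsto_uniform_limitI[OF l that] qpoch_tendsto[OF q] LIMSEQ_unique by blast
    then have "uniform_limit (cball x 1) (\<lambda>n y. qpoch y q n) (\<lambda>y. qpoch_inf y q) sequentially"
      using l uniform_limit_cong'[of "cball x 1" "\<lambda>n y. qpoch y q n" "\<lambda>n y. qpoch y q n" l "\<lambda>y. qpoch_inf y q"] by auto
    then show "\<exists>d>0. cball x d \<subseteq> UNIV \<and> uniform_limit (cball x d) (\<lambda>n y. qpoch y q n) (\<lambda>y. qpoch_inf y q) sequentially"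
      by (intro exI[of _ 1]) auto
  qed auto
  then show ?thesis by (rule holomorphic_on_subset) auto
qed

lemma holomorphic_qpoch_inf_compose [holomorphic_intros]:
  assumes "cmod q < 1" "g holomorphic_on A"
  shows "(\<lambda>x. qpoch_inf (g x) q) holomorphic_on A"
  using holomorphic_on_compose[OF assms(2) holomorphic_qpoch_inf[OF assms(1)]] by (simp add: o_def)

lemma continuous_on_qpoch_inf [continuous_intros]:
  assumes "cmod q < 1" "continuous_on A g"
  shows "continuous_on A (\<lambda>x. qpoch_inf (g x) q)"
  using continuous_on_compose2[OF holomorphic_on_imp_continuous_on[OF holomorphic_qpoch_inf[OF assms(1), of UNIV]] assms(2)]
  by auto

lemma continuous_on_qpoch [continuous_intros]:
  assumes "continuous_on A g"
  shows "continuous_on A (\<lambda>x. qpoch (g x) q n)"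
  unfolding qpoch_def by (intro continuous_intros assms)

lemma tendsto_qpoch_inf [tendsto_intros]:
  assumes "cmod q < 1" "(g \<longlongrightarrow> l) F"
  shows "((\<lambda>x. qpoch_inf (g x) q) \<longlongrightarrow> qpoch_inf l q) F"
proof -
  have "isCont (\<lambda>x. qpoch_inf x q) l"
    using continuous_on_qpoch_inf[OF assms(1) continuous_on_id, of UNIV]
    by (simp add: continuous_on_eq_continuous_at)
  then show ?thesis using assms(2) by (rule isCont_tendsto_compose)
qed

lemma tendsto_qpoch [tendsto_intros]:
  assumes "(g \<longlongrightarrow> l) F"
  shows "((\<lambda>x. qpoch (g x) q n) \<longlongrightarrow> qpoch l q n) F"
  unfolding qpoch_def by (intro tendsto_intros assms)

text \<open>The factor 1 - x leaves the first product and 1 - 1/x enters the second; their quotient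
  is -x. The peeling identities are kept multiplied out, so x = 1, where both sides vanish, needs no
  separate case.\<close>

lemma qtheta_shift:
  assumes "cmod q < 1" "x \<noteq> 0" "q \<noteq> 0"
  shows "qtheta x q = - x * qtheta (q * x) q"
proof -
  have 1: "qpoch_inf x q = (1 - x) * qpoch_inf (q * x) q"
    using qpoch_inf_Suc[OF assms(1), of x] by (simp add: mult.commute)
  have 2: "x * qpoch_inf (1 / x) q = (x - 1) * qpoch_inf (q / x) q"
    using qpoch_inf_Suc[OF assms(1), of "1 / x"] assms(2) by (simp add: field_simps)
  have "- x * qtheta (q * x) q = - (qpoch_inf (q * x) q * (x * qpoch_inf (1 / x) q))"
    using assms(3) by (simp add: qtheta_def)
  also have "\<dots> = qtheta x q"
    unfolding 2 by (simp add: 1 qtheta_def algebra_simps)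
  finally show ?thesis ..
qed

section \<open>Recursions along a geometric orbit\<close>

lemma tendsto_zero_orbit:
  fixes q :: complex
  assumes "cmod q < 1"
  shows "(\<lambda>n. x * q ^ n) \<longlonglongrightarrow> 0"
  using tendsto_mult[OF tendsto_const LIMSEQ_power_zero[OF assms]] by simp

text \<open>A sequence satisfying this recursion along the orbit \<open>\<beta> n = \<alpha> q ^ n\<close> is determined by its
  limit at the end of the orbit, and also by its value at the start.\<close>

lemma orbit_zero_from_limit:
  fixes z :: "nat \<Rightarrow> nat \<Rightarrow> complex"
  assumes "\<And>n. z 0 n = z 0 (Suc n)"
    and "\<And>k n. z (Suc k) n = z (Suc k) (Suc n) - \<beta> n * z k (Suc n)"
    and lim: "\<And>k. z k \<longlonglongrightarrow> 0"
  shows "z k n = 0"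
proof (induction k arbitrary: n)
  case 0
  have "z 0 n = z 0 0" for n by (induction n) (simp, metis assms(1))
  then have "z 0 = (\<lambda>_. z 0 0)" by blast
  with lim[of 0] have "z 0 0 = 0" by (metis LIMSEQ_const_iff)
  then show ?case using \<open>z 0 = (\<lambda>_. z 0 0)\<close> by metis
next
  case (Suc k)
  \<comment> \<open>The last term of the recursion dies by the induction hypothesis, so
    \<open>z (Suc k)\<close> is again constant along the orbit and equals its limit.\<close>
  have *: "z (Suc k) (Suc n) = z (Suc k) n" for n
    using assms(2)[of k n] Suc[of "Suc n"] by (metis diff_zero mult_zero_right)
  have "z (Suc k) n = z (Suc k) 0" for n by (induction n) (simp_all add: *)
  then have "z (Suc k) = (\<lambda>_. z (Suc k) 0)" by blast
  with lim[of "Suc k"] have "z (Suc k) 0 = 0" by (metis LIMSEQ_const_iff)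
  then show ?case using \<open>z (Suc k) = (\<lambda>_. z (Suc k) 0)\<close> by metis
qed

lemma orbit_zero_from_start:
  fixes z :: "nat \<Rightarrow> nat \<Rightarrow> complex"
  assumes z0: "\<And>n. z 0 n = z 0 (Suc n)"
    and zS: "\<And>k n. z (Suc k) n = z (Suc k) (Suc n) - \<beta> n * z k (Suc n)"
    and start: "\<And>k. z k 0 = 0"
  shows "z k n = 0"
proof (induction k arbitrary: n)
  case 0
  show ?case by (induction n) (simp add: start, metis z0)
next
  case (Suc k)
  have "z (Suc k) (Suc n) = z (Suc k) n" for n
    using zS[of k n] Suc[of "Suc n"] by (metis diff_zero mult_zero_right)
  then show ?case by (induction n) (simp_all add: start)
qed

subsection \<open>Integrals over circles\<close>

text \<open>Substituting w = exp u turns the annulus into a convex vertical strip or half-plane, on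
  which J(exp u) has a primitive \<open>H\<close>. The integral over any circle is the increment of
  \<open>H\<close> under u -> u + 2 pi i, divided by i, and this increment does not depend on u. The
  base points \<open>w1\<close>, \<open>w2\<close> are complex, so the circles may also be rotated
  against each other.\<close>

lemma circle_integral_shift:
  assumes J: "J holomorphic_on {w. lo < cmod w \<and> cmod w < hi}" and "0 \<le> lo"
    and w1: "lo < cmod w1" "cmod w1 < hi" and w2: "lo < cmod w2" "cmod w2 < hi"
  shows "integral {-pi..pi} (\<lambda>\<psi>. J (w1 * cis \<psi>)) = integral {-pi..pi} (\<lambda>\<psi>. J (w2 * cis \<psi>))"
proof -
  define S where "S = Re -` {x. lo < exp x \<and> exp x < hi}"
  have "is_interval {x::real. lo < exp x \<and> exp x < hi}"
    unfolding is_interval_1 by (auto intro: less_le_trans le_less_trans)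
  then have S: "convex S"
    unfolding S_def by (intro convex_linear_vimage) (auto simp: is_interval_convex_1 bounded_linear.linear[OF bounded_linear_Re])
  have "open {x::real. lo < exp x \<and> exp x < hi}"
    by (intro open_Collect_conj open_Collect_less continuous_intros)
  then have oS: "open S"
    unfolding S_def by (intro open_vimage continuous_intros)
  have "(\<lambda>u. J (exp u)) holomorphic_on S"
  proof (rule holomorphic_on_compose_gen[OF holomorphic_on_exp J, of S, unfolded o_def])
    show "exp ` S \<subseteq> {w. lo < cmod w \<and> cmod w < hi}"
      by (auto simp: S_def)
  qed
  then obtain H where "\<And>u. u \<in> S \<Longrightarrow> (H has_field_derivative J (exp u)) (at u within S)"
    using holomorphic_convex_primitive'[OF S oS] by blast
  then have H: "(H has_field_derivative J (exp u)) (at u)" if "u \<in> S" for u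
    using that oS by (metis at_within_open)
  have SI: "u + \<i> * of_real x \<in> S \<longleftrightarrow> u \<in> S" for u x
    by (simp add: S_def)
  \<comment> \<open>\<open>H\<close> and its translate have the same derivative, since exp has
    period 2 pi i.\<close>
  have "((\<lambda>u. H (u + 2 * of_real pi * \<i>) - H u) has_field_derivative 0) (at u within S)" if u: "u \<in> S" for u
  proof -
    have "u + 2 * of_real pi * \<i> \<in> S" using SI[of u "2 * pi"] u by (simp add: mult_ac)
    from H[OF this] have "(H has_field_derivative J (exp u)) (at (u + 2 * of_real pi * \<i>))"
      by (simp add: exp_add exp_two_pi_i)
    then have "((\<lambda>u. H (u + 2 * of_real pi * \<i>)) has_field_derivative J (exp u)) (at u)"
      by (simp add: DERIV_shift)
    from DERIV_diff[OF this H[OF u]] show ?thesis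
      by (auto intro: has_field_derivative_at_within)
  qed
  from has_field_derivative_zero_constant[OF S this]
  obtain c where c: "\<And>u. u \<in> S \<Longrightarrow> H (u + 2 * of_real pi * \<i>) - H u = c"
    by blast
  have *: "integral {-pi..pi} (\<lambda>\<psi>. J (w * cis \<psi>)) = c / \<i>" if w: "lo < cmod w" "cmod w < hi" for w
  proof -
    define u where "u = Ln w"
    have "w \<noteq> 0" using w \<open>0 \<le> lo\<close> by auto
    then have eu: "exp u = w" by (simp add: u_def)
    have uS: "u \<in> S"
      using w eu norm_exp_eq_Re[of u] by (simp add: S_def)
    have "((\<lambda>\<psi>. J (w * cis \<psi>)) has_integral (H (u + \<i> * of_real pi) / \<i> - H (u + \<i> * of_real (-pi)) / \<i>)) {-pi..pi}"
    proof (rule fundamental_theorem_of_calculus)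
      fix x :: real
      have "((\<lambda>x. u + \<i> * of_real x) has_vector_derivative \<i>) (at x)"
        by (auto intro!: derivative_eq_intros)
      moreover have "(H has_field_derivative J (exp (u + \<i> * of_real x))) (at (u + \<i> * of_real x))"
        using H SI uS by blast
      ultimately have "((\<lambda>x. H (u + \<i> * of_real x)) has_vector_derivative \<i> * J (exp (u + \<i> * of_real x))) (at x)"
        using field_vector_diff_chain_at by (fastforce simp: o_def)
      then have "((\<lambda>x. H (u + \<i> * of_real x) / \<i>) has_vector_derivative (\<i> * J (exp (u + \<i> * of_real x))) / \<i>) (at x)"
        by (rule has_vector_derivative_divide)
      moreover have "exp (u + \<i> * of_real x) = w * cis x"
        by (simp add: exp_add eu cis_conv_exp)
      ultimately show "((\<lambda>x. H (u + \<i> * of_real x) / \<i>) has_vector_derivative J (w * cis x)) (at x within {-pi..pi})"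
        by (simp add: has_vector_derivative_at_within)
    qed auto
    moreover have "H (u + \<i> * of_real pi) - H (u + \<i> * of_real (-pi)) = c"
      using c[of "u + \<i> * of_real (-pi)"] SI[of u "-pi"] uS by (simp add: algebra_simps)
    then have "H (u + \<i> * of_real pi) / \<i> - H (u + \<i> * of_real (-pi)) / \<i> = c / \<i>"
      by (metis diff_divide_distrib)
    ultimately show ?thesis by (metis integral_unique)
  qed
  show ?thesis using *[OF w1] *[OF w2] by simp
qed

text \<open>A primitive is i Ln(1 - x exp(i \<psi>)): as |x| < 1, the argument of Ln stays in the
  right half-plane, so the principal branch is differentiable there, and its values at the two ends
  agree.\<close>

lemma circle_integral_geometric:
  assumes x: "cmod x < 1"
  shows "((\<lambda>\<psi>. x * cis \<psi> / (1 - x * cis \<psi>)) has_integral 0) {-pi..pi}"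
proof -
  have "((\<lambda>\<psi>. x * cis \<psi> / (1 - x * cis \<psi>)) has_integral (\<i> * Ln (1 - x * cis pi) - \<i> * Ln (1 - x * cis (-pi)))) {-pi..pi}"
  proof (rule fundamental_theorem_of_calculus)
    fix t :: real
    have n: "cmod (x * cis t) < 1" using x by (simp add: norm_mult)
    then have "0 < Re (1 - x * cis t)"
      using complex_Re_le_cmod[of "x * cis t"] by simp
    then have nr: "1 - x * cis t \<notin> \<real>\<^sub>\<le>\<^sub>0" by (auto simp: complex_nonpos_Reals_iff)
    have "((\<lambda>u. \<i> * Ln (1 - x * exp (\<i> * u))) has_field_derivative x * cis t / (1 - x * cis t)) (at (of_real t))"
    proof -
      have "((\<lambda>u. \<i> * Ln (1 - x * exp (\<i> * u))) has_field_derivative 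
          \<i> * (inverse (1 - x * cis t) * (- (x * (cis t * \<i>))))) (at (of_real t))"
        using nr by (auto intro!: derivative_eq_intros simp: cis_conv_exp)
      moreover have "\<i> * (inverse (1 - x * cis t) * (- (x * (cis t * \<i>)))) = - (\<i> * \<i>) * (x * cis t / (1 - x * cis t))"
        by (simp only: divide_inverse mult_ac mult_minus_right mult_minus_left)
      ultimately show ?thesis by simp
    qed
    from has_vector_derivative_real_field[OF this]
    show "((\<lambda>t. \<i> * Ln (1 - x * cis t)) has_vector_derivative x * cis t / (1 - x * cis t)) (at t within {-pi..pi})"
      by (simp add: cis_conv_exp)
  qed auto
  then show ?thesis by (simp add: cis.code)
qed

lemma continuous_on_circle [continuous_intros]:
  assumes "continuous_on (sphere 0 (cmod r)) f"
  shows "continuous_on A (\<lambda>\<psi>. f (r * cis \<psi>))"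
  by (rule continuous_on_compose2[OF assms]) (auto intro!: continuous_intros simp: norm_mult)

text \<open>The only pole between the two circles is at \<open>e\<close>. Subtracting
  \<open>N e\<close> from \<open>N\<close> leaves a function analytic across \<open>e\<close>, whose
  integrals over both circles agree; the constant part is integrated directly and contributes 2 pi
  outside the unit circle and 0 inside.\<close>

lemma circle_integral_residue:
  assumes N: "N holomorphic_on {w. r < cmod w}" and r: "0 \<le> r" "r < r'" "r' < 1" and R: "1 < R" and e: "cmod e = 1"
  shows "integral {-pi..pi} (\<lambda>\<psi>. N (of_real R * cis \<psi>) / (1 - e / (of_real R * cis \<psi>)))
    = 2 * of_real pi * N e + integral {-pi..pi} (\<lambda>\<psi>. N (of_real r' * cis \<psi>) / (1 - e / (of_real r' * cis \<psi>)))"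
proof -
  \<comment> \<open>The factor \<open>z\<close> comes from 1 / (1 - e / z) = z / (z - e); the
    derivative fills the removable singularity.\<close>
  define J where "J z = (if z = e then deriv N e else (N z - N e) / (z - e)) * z" for z
  have "open {w. r < cmod w}" by (intro open_Collect_less continuous_intros)
  with pole_lemma_open[OF N, of e] have J: "J holomorphic_on {w. r < cmod w}"
    unfolding J_def by (intro holomorphic_on_mult holomorphic_on_ident) auto
  have shift: "integral {-pi..pi} (\<lambda>\<psi>. J (of_real R * cis \<psi>)) = integral {-pi..pi} (\<lambda>\<psi>. J (of_real r' * cis \<psi>))"
    by (rule circle_integral_shift[where lo = r and hi = "R + 1"]) (use r R in \<open>auto intro!: holomorphic_on_subset[OF J]\<close>)
  have int_J: "(\<lambda>\<psi>. J (of_real s * cis \<psi>)) integrable_on {-pi..pi}" if "r < s" for s :: real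
  proof -
    have "continuous_on (sphere 0 (cmod (of_real s))) J"
      using that r(1) by (intro holomorphic_on_imp_continuous_on holomorphic_on_subset[OF J]) auto
    then show ?thesis by (intro integrable_continuous_real continuous_on_circle)
  qed
  have split: "N (of_real s * cis \<psi>) / (1 - e / (of_real s * cis \<psi>)) =
     J (of_real s * cis \<psi>) + N e * (1 / (1 - e / (of_real s * cis \<psi>)))" if "r < s" "s \<noteq> 1" for s \<psi>
  proof -
    let ?w = "of_real s * cis \<psi>"
    have "cmod ?w = s" using that r by (simp add: norm_mult)
    then have "?w \<noteq> 0" "?w \<noteq> e" using that r e by auto
    then show ?thesis by (simp add: J_def divide_simps) (simp add: algebra_simps)
  qed
  \<comment> \<open>Outside the unit circle, 1 / (1 - X) = 1 + X / (1 - X) with X = e / w; the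
    reflection \<psi> -> -\<psi> brings the second term into the form of
    \<open>circle_integral_geometric\<close>.\<close>
  have hR: "((\<lambda>\<psi>. 1 / (1 - e / (of_real R * cis \<psi>))) has_integral 2 * of_real pi) {-pi..pi}"
  proof -
    have "((\<lambda>\<psi>. (e / of_real R) * cis \<psi> / (1 - (e / of_real R) * cis \<psi>)) has_integral 0) {-pi..pi}"
      by (rule circle_integral_geometric) (use R e in \<open>simp add: norm_divide\<close>)
    then have "((\<lambda>\<psi>. (e / of_real R) * cis (-\<psi>) / (1 - (e / of_real R) * cis (-\<psi>))) has_integral 0) {-pi..pi}"
      using has_integral_reflect_real[where a = "-pi" and b = pi and f = "\<lambda>\<psi>. (e / of_real R) * cis \<psi> / (1 - (e / of_real R) * cis \<psi>)" and i = 0] by simp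
    then have "((\<lambda>\<psi>. 1 + (e / of_real R) * cis (-\<psi>) / (1 - (e / of_real R) * cis (-\<psi>))) has_integral (2 * of_real pi + 0)) {-pi..pi}"
      using has_integral_const_real[of "1::complex" "-pi" pi]
      by (intro has_integral_add) (auto simp: scaleR_conv_of_real)
    moreover have "1 + (e / of_real R) * cis (-\<psi>) / (1 - (e / of_real R) * cis (-\<psi>)) = 1 / (1 - e / (of_real R * cis \<psi>))" for \<psi>
    proof -
      have "cmod ((e / of_real R) * cis (-\<psi>)) < 1" using R e by (simp add: norm_divide norm_mult)
      then have "1 - (e / of_real R) * cis (-\<psi>) \<noteq> 0" by auto
      moreover have "e / (of_real R * cis \<psi>) = (e / of_real R) * cis (-\<psi>)" by (simp add: divide_inverse mult_ac)
      moreover have "1 + X / (1 - X) = 1 / (1 - X)" if "1 - X \<noteq> 0" for X :: complex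
        using that by (simp add: field_simps)
      ultimately show ?thesis by metis
    qed
    ultimately show ?thesis by simp
  qed
  \<comment> \<open>Inside, 1 / (1 - e / w) = -(w / e) / (1 - w / e), again a geometric tail with
    mean zero.\<close>
  have hr: "((\<lambda>\<psi>. 1 / (1 - e / (of_real r' * cis \<psi>))) has_integral 0) {-pi..pi}"
  proof -
    have "((\<lambda>\<psi>. (of_real r' / e) * cis \<psi> / (1 - (of_real r' / e) * cis \<psi>)) has_integral 0) {-pi..pi}"
      by (rule circle_integral_geometric) (use r e in \<open>simp add: norm_divide\<close>)
    from has_integral_neg[OF this]
    have "((\<lambda>\<psi>. - ((of_real r' / e) * cis \<psi> / (1 - (of_real r' / e) * cis \<psi>))) has_integral 0) {-pi..pi}" by simp
    moreover have "- ((of_real r' / e) * cis \<psi> / (1 - (of_real r' / e) * cis \<psi>)) = 1 / (1 - e / (of_real r' * cis \<psi>))" for \<psi>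
    proof -
      have "cmod (of_real r' * cis \<psi>) = r'" using r by (simp add: norm_mult)
      then have "of_real r' * cis \<psi> \<noteq> 0" "of_real r' * cis \<psi> \<noteq> e" using r e by auto
      moreover have "e \<noteq> 0" using e by auto
      ultimately show ?thesis by (simp add: divide_simps) (simp add: algebra_simps)
    qed
    ultimately show ?thesis by simp
  qed
  have "integral {-pi..pi} (\<lambda>\<psi>. N (of_real s * cis \<psi>) / (1 - e / (of_real s * cis \<psi>)))
     = integral {-pi..pi} (\<lambda>\<psi>. J (of_real s * cis \<psi>)) + N e * I"
    if I: "((\<lambda>\<psi>. 1 / (1 - e / (of_real s * cis \<psi>))) has_integral I) {-pi..pi}" and s: "r < s" "s \<noteq> 1" for s I
    unfolding split[OF s]
    by (intro integral_unique has_integral_add integrable_integral int_J has_integral_mult_right I s)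
  from this[OF hR] this[OF hr] show ?thesis using shift r R by simp
qed

subsection \<open>The integral functional\<close>

text \<open>The homogeneous form of w^k (b/w; q)_k. It is polynomial in b and w, so b may run down
  to 0, where it becomes the monomial w^k.\<close>

definition qlin :: "complex \<Rightarrow> complex \<Rightarrow> nat \<Rightarrow> complex \<Rightarrow> complex" where
  "qlin b q k w = (\<Prod>j<k. w - b * q ^ j)"

lemma qlin_0 [simp]: "qlin b q 0 w = 1"
  by (simp add: qlin_def)

lemma qlin_Suc: "qlin b q (Suc k) w = qlin b q k w * (w - b * q ^ k)"
  by (simp add: qlin_def)

lemma qlin_Suc_left: "qlin b q (Suc k) w = (w - b) * qlin (b * q) q k w"
  by (simp add: qlin_def prod.lessThan_Suc_shift mult_ac del: prod.lessThan_Suc)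

lemma qlin_zero_left [simp]: "qlin 0 q k w = w ^ k"
  by (simp add: qlin_def)

lemma qlin_scale: "qlin b q (Suc k) (q * w) = q ^ k * (q * w - b) * qlin b q k w"
proof -
  have "qlin (b * q) q k (q * w) = q ^ k * qlin b q k w"
    by (induction k) (simp_all add: qlin_Suc algebra_simps)
  then show ?thesis by (simp add: qlin_Suc_left)
qed

lemma qlin_qpoch: "w \<noteq> 0 \<Longrightarrow> qlin b q k w = w ^ k * qpoch (b / w) q k"
  by (induction k) (simp_all add: qlin_Suc qpoch_Suc field_simps)

text \<open>The two products of length k + 1 share the factors with b q, ..., b q^k, and the
  remaining ones differ by the constant b (1 - q^(k+1)). After division by
  \<open>qpoch q q k\<close> this is the recursion of the orbit lemmas.\<close>

lemma qlin_orbit: "qlin b q (Suc k) w = qlin (b * q) q (Suc k) w - b * (1 - q ^ Suc k) * qlin (b * q) q k w"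
  unfolding qlin_Suc_left[of b] qlin_Suc[of "b * q"] by (simp add: algebra_simps)

lemma continuous_on_qlin [continuous_intros]:
  "continuous_on A f \<Longrightarrow> continuous_on A g \<Longrightarrow> continuous_on A (\<lambda>x. qlin (f x) q k (g x))"
  unfolding qlin_def by (intro continuous_intros)

lemma holomorphic_qlin [holomorphic_intros]:
  "f holomorphic_on A \<Longrightarrow> (\<lambda>x. qlin b q k (f x)) holomorphic_on A"
  unfolding qlin_def by (intro holomorphic_intros)

section \<open>The kernel and the functional \<open>L\<close>\<close>

locale qkernel =
  fixes q e p :: complex and R \<rho> :: real
  assumes q: "q \<noteq> 0" "cmod q < 1" and e: "cmod e = 1" and p: "p \<noteq> 0" and R: "1 < R" "R < \<rho>"
begin

definition kern :: "complex \<Rightarrow> complex" where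
  "kern w = qtheta (p * w) q * qtheta (p / w) q / (qpoch_inf (e / w) q * qpoch_inf (1 / (e * w)) q)"

definition L :: "(complex \<Rightarrow> complex) \<Rightarrow> complex" where
  "L F = integral {-pi..pi} (\<lambda>\<psi>. kern (of_real R * cis \<psi>) * F (of_real R * cis \<psi>))"

lemma e_nz [simp]: "e \<noteq> 0"
  using e by auto

lemma kern_denom_nonzero:
  assumes "1 < cmod w"
  shows "qpoch_inf (e / w) q \<noteq> 0" "qpoch_inf (1 / (e * w)) q \<noteq> 0"
proof -
  have "cmod (e / w) < 1" "cmod (1 / (e * w)) < 1"
    using assms e by (simp_all add: norm_divide norm_mult divide_simps)
  then show "qpoch_inf (e / w) q \<noteq> 0" "qpoch_inf (1 / (e * w)) q \<noteq> 0"
    using qpoch_inf_nonzero[OF q(2)] by blast+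
qed

lemma holomorphic_theta_pair:
  "(\<lambda>w. qtheta (p * w) q * qtheta (p / w) q) holomorphic_on (- {0})"
  unfolding qtheta_def using q p by (intro holomorphic_intros) auto

lemma holomorphic_kern: "kern holomorphic_on {w. 1 < cmod w}"
  unfolding kern_def
  by (intro holomorphic_on_divide holomorphic_on_subset[OF holomorphic_theta_pair] holomorphic_intros)
    (use q kern_denom_nonzero in auto)

lemma continuous_on_kern: "continuous_on (sphere 0 R) kern"
  by (rule holomorphic_on_imp_continuous_on, rule holomorphic_on_subset[OF holomorphic_kern]) (use R in auto)

text \<open>Each theta function contributes its quasi-period factor and each denominator loses one
  factor; \<open>p\<close> cancels, so the functional equation does not depend on it. The hypothesis
  keeps both v and q v outside the unit disc, where the denominators of \<open>kern\<close> do not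
  vanish.\<close>

lemma kern_shift:
  assumes "1 < cmod (q * v)"
  shows "q * kern v = (q * v - e) * (q * v - 1 / e) * kern (q * v)"
proof -
  have v: "v \<noteq> 0" using assms by auto
  have "cmod v \<ge> cmod (q * v)" using q by (simp add: norm_mult mult_left_le_one_le)
  then have v1: "1 < cmod v" using assms by simp
  have t1: "qtheta (p * v) q = - (p * v) * qtheta (p * (q * v)) q"
    using qtheta_shift[of q "p * v"] q p v by (simp add: mult_ac)
  have t2: "qtheta (p / (q * v)) q = - (p / (q * v)) * qtheta (p / v) q"
    using qtheta_shift[of q "p / (q * v)"] q p v by simp
  have d1: "qpoch_inf (e / (q * v)) q = (1 - e / (q * v)) * qpoch_inf (e / v) q"
    using qpoch_inf_Suc[of q "e / (q * v)"] q by simp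
  have d2: "qpoch_inf (1 / (e * (q * v))) q = (1 - 1 / (e * (q * v))) * qpoch_inf (1 / (e * v)) q"
    using qpoch_inf_Suc[of q "1 / (e * (q * v))"] q by simp
  define D where "D = qpoch_inf (e / v) q * qpoch_inf (1 / (e * v)) q"
  define T where "T = qtheta (p * (q * v)) q * qtheta (p / v) q"
  have nz: "1 - e / (q * v) \<noteq> 0" "1 - 1 / (e * (q * v)) \<noteq> 0" "D \<noteq> 0"
    using kern_denom_nonzero[OF assms] d1 d2 kern_denom_nonzero[OF v1] by (auto simp: D_def)
  have k1: "kern v = - (p * v) * T / D"
    unfolding kern_def t1 by (simp add: T_def D_def)
  have k2: "kern (q * v) = - (p / (q * v)) * T / ((1 - e / (q * v)) * (1 - 1 / (e * (q * v))) * D)"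
    unfolding kern_def t2 d1 d2 by (simp add: T_def D_def mult_ac)
  have m: "(q * v - e) * (q * v - 1 / e) = (q * v)\<^sup>2 * ((1 - e / (q * v)) * (1 - 1 / (e * (q * v))))"
    using q v by (simp add: field_simps power2_eq_square)
  define X where "X = (1 - e / (q * v)) * (1 - 1 / (e * (q * v)))"
  have "X \<noteq> 0" using nz by (simp add: X_def)
  show ?thesis
    unfolding m k1 k2 X_def[symmetric] using q v nz(3) \<open>X \<noteq> 0\<close> by (simp add: field_simps power2_eq_square)
qed

lemma L_cong: "(\<And>w. cmod w = R \<Longrightarrow> F w = G w) \<Longrightarrow> L F = L G"
  unfolding L_def using R by (simp add: norm_mult)

lemma L_integrable: "continuous_on (sphere 0 R) F \<Longrightarrow> 
    (\<lambda>\<psi>. kern (of_real R * cis \<psi>) * F (of_real R * cis \<psi>)) integrable_on {-pi..pi}"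
  using continuous_on_kern R
  by (intro integrable_continuous_real continuous_on_mult continuous_on_circle) auto

lemma L_add: "continuous_on (sphere 0 R) F \<Longrightarrow> continuous_on (sphere 0 R) G \<Longrightarrow> L (\<lambda>w. F w + G w) = L F + L G"
  unfolding L_def by (simp add: distrib_left integral_add L_integrable)

lemma L_cmult: "L (\<lambda>w. c * F w) = c * L F"
  unfolding L_def by (simp add: mult.left_commute[of _ c])

lemma L_diff: "continuous_on (sphere 0 R) F \<Longrightarrow> continuous_on (sphere 0 R) G \<Longrightarrow> L (\<lambda>w. F w - G w) = L F - L G"
  unfolding L_def by (simp add: right_diff_distrib integral_diff L_integrable)

lemma L_sum: "finite I \<Longrightarrow> (\<And>i. i \<in> I \<Longrightarrow> continuous_on (sphere 0 R) (F i)) \<Longrightarrow> L (\<lambda>w. \<Sum>i\<in>I. F i w) = (\<Sum>i\<in>I. L (F i))"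
  unfolding L_def by (simp add: sum_distrib_left integral_sum L_integrable)

lemma continuous_on_sphere_divide:
  fixes F :: "complex \<Rightarrow> complex"
  shows "continuous_on (sphere 0 R) F \<Longrightarrow> continuous_on (sphere 0 R) (\<lambda>w. F w / w)"
  using R by (intro continuous_on_divide continuous_on_id) auto

lemma continuous_on_sphere_scale:
  assumes "g holomorphic_on ball 0 \<rho>"
  shows "continuous_on (sphere 0 R) g" "continuous_on (sphere 0 R) (\<lambda>w. g (q * w))"
proof -
  have g: "continuous_on (ball 0 \<rho>) g" using assms by (rule holomorphic_on_imp_continuous_on)
  then show "continuous_on (sphere 0 R) g" by (rule continuous_on_subset) (use R in auto)
  have "cmod q * R < \<rho>" using R q by (smt (verit) mult_left_le_one_le norm_ge_zero)
  then show "continuous_on (sphere 0 R) (\<lambda>w. g (q * w))"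
    by (intro continuous_on_compose2[OF g] continuous_intros) (auto simp: norm_mult)
qed

text \<open>The contour moves from radius R to R / |q|, and the substitution w = q v brings it back,
  at the price of the factor in \<open>kern_shift\<close>. The condition R < \<rho> leaves room for
  this, because g(q v) is analytic for |v| < \<rho> / |q|.\<close>

lemma L_shift:
  assumes g: "g holomorphic_on ball 0 \<rho>"
  shows "L (\<lambda>w. (w - e) * (w - 1 / e) * g w / w) = L (\<lambda>w. g (q * w) / w)"
proof -
  define J where "J v = kern v * (g (q * v) / v)" for v
  have q': "0 < cmod q" using q by simp
  have J: "J holomorphic_on {v. 1 < cmod v \<and> cmod v < \<rho> / cmod q}"
    unfolding J_def
    by (intro holomorphic_intros holomorphic_on_subset[OF holomorphic_kern] 
        holomorphic_on_compose_gen[OF _ g, unfolded o_def])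
      (use q' in \<open>auto simp: norm_mult field_simps\<close>)
  have "R \<le> R / cmod q" using q q' R by (simp add: field_simps)
  then have b: "1 < R / cmod q" "R / cmod q < \<rho> / cmod q" "R < \<rho> / cmod q"
    using R(1) divide_strict_right_mono[OF R(2) q'] by linarith+
  have "L (\<lambda>w. g (q * w) / w) = integral {-pi..pi} (\<lambda>\<psi>. J (of_real R * cis \<psi>))"
    by (simp add: L_def J_def)
  \<comment> \<open>The new base point is R / q rather than R / |q|, so that multiplication by q
    gives the original parametrization exactly.\<close>
  also have "\<dots> = integral {-pi..pi} (\<lambda>\<psi>. J (of_real R / q * cis \<psi>))"
    by (rule circle_integral_shift[OF J]) (use R b in \<open>auto simp: norm_divide\<close>)
  also have "\<dots> = L (\<lambda>w. (w - e) * (w - 1 / e) * g w / w)"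
    unfolding L_def
  proof (rule integral_cong)
    fix \<psi>
    define w where "w = of_real R * cis \<psi>"
    have w: "cmod w = R" using R by (simp add: w_def norm_mult)
    then have "w \<noteq> 0" using R by auto
    have "1 < cmod (q * (w / q))" using w q R by simp
    from kern_shift[OF this] have "q * kern (w / q) = (w - e) * (w - 1 / e) * kern w" using q by simp
    moreover have "J (w / q) = (q * kern (w / q)) * g w / w"
      using q by (simp add: J_def)
    ultimately have "J (w / q) = kern w * ((w - e) * (w - 1 / e) * g w / w)"
      by (simp add: mult_ac)
    then show "J (of_real R / q * cis \<psi>) = kern (of_real R * cis \<psi>) * ((of_real R * cis \<psi> - e) * (of_real R * cis \<psi> - 1 / e) * g (of_real R * cis \<psi>) / (of_real R * cis \<psi>))"
      by (simp add: w_def)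
  qed
  finally show ?thesis ..
qed

text \<open>\<open>L_shift\<close> rearranged by means of (w - e)(w - 1/e) / w = w - (e + 1/e) +
  1/w.\<close>

lemma L_recurrence:
  assumes g: "g holomorphic_on ball 0 \<rho>"
  shows "(e + 1 / e) * L g = L (\<lambda>w. w * g w + (g w - g (q * w)) / w)"
proof -
  note c = continuous_on_sphere_scale[OF g]
  have c1: "continuous_on (sphere 0 R) (\<lambda>w. w * g w + (g w - g (q * w)) / w)"
    by (intro continuous_on_add continuous_on_mult continuous_on_sphere_divide continuous_on_diff c continuous_on_id)
  have c2: "continuous_on (sphere 0 R) (\<lambda>w. (w - e) * (w - 1 / e) * g w / w)"
    by (intro continuous_on_mult continuous_on_sphere_divide continuous_on_diff c continuous_on_id continuous_on_const)
  have "L (\<lambda>w. (e + 1 / e) * g w) = L (\<lambda>w. (w * g w + (g w - g (q * w)) / w) - ((w - e) * (w - 1 / e) * g w / w - g (q * w) / w))"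
  proof (rule L_cong)
    fix w :: complex assume "cmod w = R"
    then have "w \<noteq> 0" using R by auto
    then show "(e + 1 / e) * g w = (w * g w + (g w - g (q * w)) / w) - ((w - e) * (w - 1 / e) * g w / w - g (q * w) / w)"
      by (simp add: field_simps)
  qed
  also have "\<dots> = L (\<lambda>w. w * g w + (g w - g (q * w)) / w) - (L (\<lambda>w. (w - e) * (w - 1 / e) * g w / w) - L (\<lambda>w. g (q * w) / w))"
    by (simp add: L_diff c1 c2 c continuous_on_sphere_divide continuous_on_diff)
  also have "\<dots> = L (\<lambda>w. w * g w + (g w - g (q * w)) / w)"
    by (simp add: L_shift[OF g])
  finally show ?thesis by (simp add: L_cmult)
qed

text \<open>Uses (1 - \<alpha> e)(1 - \<alpha>/e) = 1 + \<alpha>^2 - \<alpha> (e + 1/e). The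
  left-hand factor is the quotient of the products in \<open>E\<close> at \<alpha> and at \<alpha>
  q.\<close>

lemma L_recurrence':
  assumes g: "g holomorphic_on ball 0 \<rho>"
  shows "(1 - \<alpha> * e) * (1 - \<alpha> / e) * L g = L (\<lambda>w. (1 + \<alpha>\<^sup>2 - \<alpha> * w) * g w - \<alpha> * (g w - g (q * w)) / w)"
proof -
  note c = continuous_on_sphere_scale[OF g]
  have c1: "continuous_on (sphere 0 R) (\<lambda>w. w * g w + (g w - g (q * w)) / w)"
    by (intro continuous_on_add continuous_on_mult continuous_on_sphere_divide continuous_on_diff c continuous_on_id)
  have "(1 - \<alpha> * e) * (1 - \<alpha> / e) * L g = (1 + \<alpha>\<^sup>2) * L g - \<alpha> * ((e + 1 / e) * L g)"
    by (simp add: field_simps power2_eq_square)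
  also have "\<dots> = L (\<lambda>w. (1 + \<alpha>\<^sup>2) * g w - \<alpha> * (w * g w + (g w - g (q * w)) / w))"
    unfolding L_recurrence[OF g]
    by (subst L_diff) (auto simp: L_cmult intro!: continuous_intros c c1)
  also have "\<dots> = L (\<lambda>w. (1 + \<alpha>\<^sup>2 - \<alpha> * w) * g w - \<alpha> * (g w - g (q * w)) / w)"
    by (rule L_cong) (simp add: algebra_simps diff_divide_distrib)
  finally show ?thesis .
qed

section \<open>Total mass of the functional\<close>

definition mass :: complex where "mass = L (\<lambda>_. 1)"

text \<open>For b = 1/e, \<open>L_recurrence\<close> closes into a three-term recurrence in k that
  is solved by \<open>mass * e ^ k\<close>; the induction therefore carries two consecutive
  values.\<close>

lemma L_qlin_inverse: "L (qlin (1 / e) q k) = mass * e ^ k"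
proof -
  \<comment> \<open>At k = 0 the truncated index \<open>k - 1\<close> is harmless, as its
    coefficient 1 - q^0 vanishes; that instance yields the value at 1 from the value at 0.\<close>
  have rec: "(e + 1 / e) * L (qlin (1 / e) q k) = L (qlin (1 / e) q (Suc k)) + q ^ k / e * L (qlin (1 / e) q k)
      + (1 - q ^ k) * L (qlin (1 / e) q (k - 1))" for k
  proof -
    have "(e + 1 / e) * L (qlin (1 / e) q k) = L (\<lambda>w. w * qlin (1 / e) q k w + (qlin (1 / e) q k w - qlin (1 / e) q k (q * w)) / w)"
      by (rule L_recurrence) (intro holomorphic_intros)
    also have "\<dots> = L (\<lambda>w. qlin (1 / e) q (Suc k) w + q ^ k / e * qlin (1 / e) q k w + (1 - q ^ k) * qlin (1 / e) q (k - 1) w)"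
    proof (rule L_cong)
      fix w :: complex assume "cmod w = R"
      then have w: "w \<noteq> 0" using R by auto
      have "(qlin (1 / e) q k w - qlin (1 / e) q k (q * w)) / w = (1 - q ^ k) * qlin (1 / e) q (k - 1) w"
      proof (cases k)
        case (Suc j)
        have "qlin (1 / e) q k w - qlin (1 / e) q k (q * w) = w * ((1 - q ^ k) * qlin (1 / e) q j w)"
          unfolding Suc qlin_scale by (simp add: qlin_Suc field_simps)
        then show ?thesis using w Suc by simp
      qed simp
      then show "w * qlin (1 / e) q k w + (qlin (1 / e) q k w - qlin (1 / e) q k (q * w)) / w
        = qlin (1 / e) q (Suc k) w + q ^ k / e * qlin (1 / e) q k w + (1 - q ^ k) * qlin (1 / e) q (k - 1) w"
        by (simp add: qlin_Suc algebra_simps)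
    qed
    also have "\<dots> = L (qlin (1 / e) q (Suc k)) + q ^ k / e * L (qlin (1 / e) q k) + (1 - q ^ k) * L (qlin (1 / e) q (k - 1))"
      by (simp add: L_add L_cmult continuous_intros del: times_divide_eq_left times_divide_eq_right)
    finally show ?thesis .
  qed
  have "L (qlin (1 / e) q k) = mass * e ^ k \<and> L (qlin (1 / e) q (Suc k)) = mass * e ^ Suc k"
  proof (induction k)
    case 0
    have "qlin (1 / e) q 0 = (\<lambda>_. 1)" by auto
    then have "L (qlin (1 / e) q 0) = mass" by (simp add: mass_def)
    moreover from rec[of 0] this have "L (qlin (1 / e) q (Suc 0)) = mass * e"
      by (simp add: algebra_simps)
    ultimately show ?case by (simp add: mass_def[symmetric])
  next
    case (Suc k)
    from rec[of "Suc k"] Suc have "L (qlin (1 / e) q (Suc (Suc k))) = (e + 1 / e) * (mass * e ^ Suc k)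
      - q ^ Suc k / e * (mass * e ^ Suc k) - (1 - q ^ Suc k) * (mass * e ^ k)"
      by (simp add: algebra_simps)
    also have "\<dots> = mass * e ^ Suc (Suc k)" by (simp add: field_simps)
    finally show ?case using Suc by simp
  qed
  then show ?thesis ..
qed

text \<open>Passage to the end of an orbit under the integral sign, by continuity of a parameter
  integral over a compact set.\<close>

lemma L_tendsto:
  assumes cont: "continuous_on (cball 0 r \<times> sphere 0 R) (\<lambda>(x, w). h x w)"
    and x: "x \<longlonglongrightarrow> 0" "\<And>n. x n \<in> cball 0 r"
  shows "(\<lambda>n. L (h (x n))) \<longlonglongrightarrow> L (h (0 :: complex))"
proof -
  have "continuous_on (cball 0 r \<times> cbox (-pi) pi) (\<lambda>(x, \<psi>). kern (of_real R * cis \<psi>) * h x (of_real R * cis \<psi>))"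
    unfolding split_beta
    by (intro continuous_intros continuous_on_compose2[OF continuous_on_kern] continuous_on_compose2[OF cont[unfolded split_beta],
          where f = "\<lambda>y. (fst y, of_real R * cis (snd y))", simplified])
      (use R in \<open>auto simp: norm_mult\<close>)
  from integral_continuous_on_param[OF this] have c: "continuous_on (cball 0 r) (\<lambda>x. L (h x))"
    by (simp add: L_def)
  have "0 \<le> r" using x(2)[of 0] by (metis mem_cball_0 norm_ge_zero order_trans)
  then show ?thesis
    using continuous_on_tendsto_compose[OF c x(1)] x(2) by (simp add: always_eventually)
qed

lemma orbit_in_cball: "x * q ^ n \<in> cball 0 (cmod x)"
  using q by (simp add: norm_mult norm_power mult_left_le power_le_one)

text \<open>The form required by \<open>circle_integral_residue\<close>: 1 - e/w is split off, and
  the rest is analytic for |w| > |q|. The index \<open>Suc k\<close> guarantees that the factor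
  vanishing at 1/e, also on the unit circle, is cancelled.\<close>

lemma kern_qlin_inverse:
  assumes w: "1 < cmod w"
  shows "kern w * qlin (1 / e) q (Suc k) w = 
    (qtheta (p * w) q * qtheta (p / w) q * w ^ Suc k / (qpoch_inf (q * e / w) q * qpoch_inf (q ^ Suc k / (e * w)) q)) / (1 - e / w)"
proof -
  have w0: "w \<noteq> 0" using w by auto
  have 1: "qpoch_inf (e / w) q = (1 - e / w) * qpoch_inf (q * e / w) q"
    using qpoch_inf_Suc[OF q(2), of "e / w"] by (simp add: mult.commute)
  have 2: "qpoch_inf (1 / (e * w)) q = qpoch (1 / (e * w)) q (Suc k) * qpoch_inf (q ^ Suc k / (e * w)) q"
    using qpoch_inf_split[OF q(2), of "1 / (e * w)" "Suc k"] by simp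
  have 3: "qlin (1 / e) q (Suc k) w = w ^ Suc k * qpoch (1 / (e * w)) q (Suc k)"
    using qlin_qpoch[OF w0, of "1 / e" q "Suc k"] by simp
  note nz = kern_denom_nonzero[OF w]
  have "qpoch (1 / (e * w)) q (Suc k) \<noteq> 0" using nz(2) unfolding 2 by auto
  then show ?thesis
    unfolding kern_def 1 2 3 by (simp add: mult_ac)
qed

text \<open>The zeros of \<open>qlin (1 / e) q k\<close> cancel the first \<open>k\<close> poles of \<open>kern\<close> on the string \<open>q ^ j / e\<close>, so
  for \<open>k \<rightarrow> \<infinity>\<close> testing \<open>L\<close> on it leaves only the residue at \<open>e\<close>.\<close>

lemma mass_eq: "mass = 2 * of_real pi * qtheta (p * e) q * qtheta (p / e) q / qpoch_inf q q"
proof -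
  \<comment> \<open>Any radius strictly between |q| and 1 serves: \<open>N k\<close> is analytic for
    |w| > |q|, and the powers of \<open>r\<close> decay.\<close>
  define r where "r = (1 + cmod q) / 2"
  have r: "cmod q < r" "r < 1" "0 < r" using q by (auto simp: r_def add_pos_pos)
  define \<Theta> where "\<Theta> w = qtheta (p * w) q * qtheta (p / w) q" for w
  define N where "N k w = \<Theta> w * w ^ Suc k / (qpoch_inf (q * e / w) q * qpoch_inf (q ^ Suc k / (e * w)) q)" for k w
  have small: "cmod (q * e / w) < 1" "cmod (q ^ Suc k / (e * w)) < 1" if "cmod q < cmod w" for w k
  proof -
    have "w \<noteq> 0" using that q by auto
    moreover have "cmod q ^ Suc k \<le> cmod q" using q by (simp add: mult_left_le power_le_one)
    ultimately show "cmod (q * e / w) < 1" "cmod (q ^ Suc k / (e * w)) < 1"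
      using that e by (auto simp: norm_mult norm_divide norm_power divide_simps)
  qed
  have hol: "N k holomorphic_on {w. cmod q < cmod w}" for k
    unfolding N_def \<Theta>_def
    by (intro holomorphic_on_divide holomorphic_on_mult holomorphic_on_subset[OF holomorphic_theta_pair]
        holomorphic_intros)
      (use q small qpoch_inf_nonzero[OF q(2)] in auto)
  define C where "C k = integral {-pi..pi} (\<lambda>\<psi>. N k (of_real r * cis \<psi>) / (1 - e / (of_real r * cis \<psi>)))" for k
  have main: "mass * e ^ Suc k = 2 * of_real pi * N k e + C k" for k
  proof -
    have "mass * e ^ Suc k = integral {-pi..pi} (\<lambda>\<psi>. N k (of_real R * cis \<psi>) / (1 - e / (of_real R * cis \<psi>)))"
      unfolding L_qlin_inverse[symmetric] L_def
    proof (rule integral_cong)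
      fix \<psi>
      have "1 < cmod (of_real R * cis \<psi>)" using R by (simp add: norm_mult)
      from kern_qlin_inverse[OF this, of k]
      show "kern (of_real R * cis \<psi>) * qlin (1 / e) q (Suc k) (of_real R * cis \<psi>) = N k (of_real R * cis \<psi>) / (1 - e / (of_real R * cis \<psi>))"
        by (simp only: N_def \<Theta>_def)
    qed
    also have "\<dots> = 2 * of_real pi * N k e + C k"
      unfolding C_def by (rule circle_integral_residue[OF hol]) (use r R e in auto)
    finally show ?thesis .
  qed
  \<comment> \<open>Bounds uniform in k on the inner circle: \<open>B\<close> for the factors free
    of k, and \<open>D\<close> for the reciprocal of the remaining product, whose argument stays in
    the disc of radius |q| / r < 1. The power w^(k+1) then makes \<open>C k\<close> decay.\<close>
  have "\<exists>B. \<forall>w\<in>sphere 0 r. cmod (\<Theta> w / (qpoch_inf (q * e / w) q * (1 - e / w))) \<le> B"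
  proof -
    have "compact ((\<lambda>w. \<Theta> w / (qpoch_inf (q * e / w) q * (1 - e / w))) ` sphere 0 r)"
      unfolding \<Theta>_def
      by (intro compact_continuous_image continuous_intros holomorphic_on_imp_continuous_on holomorphic_on_subset[OF holomorphic_theta_pair])
        (use r q e small qpoch_inf_nonzero[OF q(2)] in auto)
    then show ?thesis by (auto dest!: compact_imp_bounded simp: bounded_iff)
  qed
  then obtain B where "\<forall>w\<in>sphere 0 r. cmod (\<Theta> w / (qpoch_inf (q * e / w) q * (1 - e / w))) \<le> B" ..
  then have B: "cmod (\<Theta> w / (qpoch_inf (q * e / w) q * (1 - e / w))) \<le> B" if "cmod w = r" for w
    using that by simp
  have "\<exists>D. \<forall>x\<in>cball 0 (cmod q / r). cmod (inverse (qpoch_inf x q)) \<le> D"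
  proof -
    have "cmod q / r < 1" using r by simp
    then have "qpoch_inf x q \<noteq> 0" if "x \<in> cball 0 (cmod q / r)" for x
      using that by (intro qpoch_inf_nonzero q) auto
    then have "compact ((\<lambda>x. inverse (qpoch_inf x q)) ` cball 0 (cmod q / r))"
      by (intro compact_continuous_image continuous_intros q) auto
    then show ?thesis by (auto dest!: compact_imp_bounded simp: bounded_iff)
  qed
  then obtain D where "\<forall>x\<in>cball 0 (cmod q / r). cmod (inverse (qpoch_inf x q)) \<le> D" ..
  then have D: "cmod (inverse (qpoch_inf x q)) \<le> D" if "cmod x \<le> cmod q / r" for x
    using that by simp
  have B0: "0 \<le> B" using order_trans[OF norm_ge_zero B[of "of_real r"]] r by simp
  have D0: "0 \<le> D" using order_trans[OF norm_ge_zero D[of 0]] r by simp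
  have Cbound: "cmod (C k) \<le> B * D * r ^ Suc k * (2 * pi)" for k
  proof -
    have "cmod (C k) \<le> B * D * r ^ Suc k * (pi - (-pi))"
      unfolding C_def
    proof (rule integral_bound)
      show "continuous_on {-pi..pi} (\<lambda>\<psi>. N k (of_real r * cis \<psi>) / (1 - e / (of_real r * cis \<psi>)))"
      proof (rule continuous_on_circle[where f = "\<lambda>w. N k w / (1 - e / w)"])
        show "continuous_on (sphere 0 (cmod (of_real r))) (\<lambda>w. N k w / (1 - e / w))"
          by (intro continuous_intros holomorphic_on_imp_continuous_on holomorphic_on_subset[OF hol]) (use r e in auto)
      qed
      fix \<psi>
      define w where "w = of_real r * cis \<psi>"
      have w: "cmod w = r" using r by (simp add: w_def norm_mult)
      have "cmod q ^ Suc k \<le> cmod q" using q by (simp add: mult_left_le power_le_one)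
      then have "cmod (q ^ Suc k / (e * w)) \<le> cmod q / r"
        using w e r by (simp add: norm_mult norm_divide norm_power divide_right_mono)
      from D[OF this] B[OF w]
      have "cmod (\<Theta> w / (qpoch_inf (q * e / w) q * (1 - e / w))) * cmod (inverse (qpoch_inf (q ^ Suc k / (e * w)) q)) * cmod (w ^ Suc k) \<le> B * D * r ^ Suc k"
        using B0 D0 w r by (intro mult_mono) (auto simp: norm_power norm_mult)
      also have "cmod (\<Theta> w / (qpoch_inf (q * e / w) q * (1 - e / w))) * cmod (inverse (qpoch_inf (q ^ Suc k / (e * w)) q)) * cmod (w ^ Suc k)
         = cmod (N k w / (1 - e / w))"
        unfolding norm_mult[symmetric] N_def by (simp add: divide_inverse mult_ac)
      finally show "cmod (N k (of_real r * cis \<psi>) / (1 - e / (of_real r * cis \<psi>))) \<le> B * D * r ^ Suc k"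
        by (simp add: w_def)
    qed auto
    then show ?thesis by (simp add: mult_ac)
  qed
  define b where "b k = C k / e ^ Suc k" for k
  have "(\<lambda>k. B * D * r ^ Suc k * (2 * pi)) \<longlonglongrightarrow> B * D * 0 * (2 * pi)"
    by (intro tendsto_intros LIMSEQ_Suc LIMSEQ_realpow_zero) (use r in auto)
  then have "(\<lambda>k. B * D * r ^ Suc k * (2 * pi)) \<longlonglongrightarrow> 0" by simp
  then have b: "b \<longlonglongrightarrow> 0"
    by (rule Lim_null_comparison[rotated]) (use Cbound e in \<open>auto simp: b_def norm_divide norm_mult norm_power\<close>)
  \<comment> \<open>The first term is the residue contribution at \<open>e\<close>. Its last product
    has argument q^(k+1) / e^2 and so tends to 1.\<close>
  have "mass = 2 * of_real pi * \<Theta> e / (qpoch_inf q q * qpoch_inf (1 / (e * e) * q * q ^ k) q) + b k" for k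
  proof -
    have "mass = (2 * of_real pi * N k e + C k) / e ^ Suc k"
      using main[of k] by (simp add: field_simps)
    also have "2 * of_real pi * N k e = (2 * of_real pi * \<Theta> e / (qpoch_inf q q * qpoch_inf (1 / (e * e) * q * q ^ k) q)) * e ^ Suc k"
      by (simp add: N_def mult_ac)
    finally show ?thesis by (simp add: b_def add_divide_distrib del: power_Suc)
  qed
  then have "(\<lambda>k. mass) = (\<lambda>k. 2 * of_real pi * \<Theta> e / (qpoch_inf q q * qpoch_inf (1 / (e * e) * q * q ^ k) q) + b k)" by blast
  moreover have "\<dots> \<longlonglongrightarrow> 2 * of_real pi * \<Theta> e / (qpoch_inf q q * qpoch_inf 0 q) + 0"
    by (intro tendsto_intros tendsto_zero_orbit b q) (use qpoch_inf_nonzero[OF q(2) q(2)] in auto)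
  ultimately have "(\<lambda>k. mass) \<longlonglongrightarrow> 2 * of_real pi * \<Theta> e / (qpoch_inf q q * qpoch_inf 0 q) + 0"
    by (simp only:)
  then show ?thesis by (simp add: LIMSEQ_const_iff \<Theta>_def mult.assoc)
qed

section \<open>Convolutions with \<open>q\<close>-binomial coefficients, and the moments of
  \<open>L\<close>\<close>

definition u :: "nat \<Rightarrow> complex \<Rightarrow> complex" where
  "u m \<alpha> = qpoch (\<alpha> * e) q m / qpoch q q m * (1 / e) ^ m"

definition conv :: "(nat \<Rightarrow> complex) \<Rightarrow> nat \<Rightarrow> complex \<Rightarrow> complex" where
  "conv y k \<alpha> = (\<Sum>m\<le>k. u m \<alpha> * y (k - m))"

lemma qq_nz [simp]: "qpoch q q n \<noteq> 0"
  by (rule qpoch_qq_nonzero[OF q(2)])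

lemma q_power_ne_1: "q ^ Suc n \<noteq> 1"
  using qq_nz[of "Suc n"] by (auto simp: qpoch_Suc)

lemma u_0 [simp]: "u 0 \<alpha> = 1"
  by (simp add: u_def)

text \<open>By the \<open>q\<close>-binomial theorem, \<open>u m \<alpha>\<close> is the coefficient
  of t^m in (\<alpha> t; q)_\<infinity> / (t/e; q)_\<infinity>, and replacing \<alpha> by \<alpha> q
  divides this by 1 - \<alpha> t. Convolution with a fixed sequence \<open>y\<close> preserves the
  recursion.\<close>

lemma u_orbit: "u (Suc m) \<alpha> = u (Suc m) (\<alpha> * q) - \<alpha> * u m (\<alpha> * q)"
proof -
  have 1: "qpoch (\<alpha> * e) q (Suc m) = (1 - \<alpha> * e) * qpoch (\<alpha> * q * e) q m"
    by (simp add: qpoch_Suc_left mult_ac)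
  have 2: "qpoch (\<alpha> * q * e) q (Suc m) = qpoch (\<alpha> * q * e) q m * (1 - \<alpha> * q * e * q ^ m)"
    by (simp add: qpoch_Suc)
  have 3: "qpoch q q (Suc m) = qpoch q q m * (1 - q ^ Suc m)" by (simp add: qpoch_Suc)
  show ?thesis
    unfolding u_def 1 2 3 using q_power_ne_1[of m] by (simp add: field_simps)
qed

lemma conv_0 [simp]: "conv y 0 \<alpha> = y 0"
  by (simp add: conv_def)

lemma conv_orbit: "conv y (Suc k) \<alpha> = conv y (Suc k) (\<alpha> * q) - \<alpha> * conv y k (\<alpha> * q)"
  unfolding conv_def
  by (simp add: sum.atMost_Suc_shift u_orbit[of _ \<alpha>] left_diff_distrib sum_subtractf sum_distrib_left mult.assoc 
      del: sum.atMost_Suc)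

lemma conv_tendsto: "(\<lambda>n. conv y k (\<alpha> * q ^ n)) \<longlonglongrightarrow> conv y k 0"
  unfolding conv_def u_def
  by (intro tendsto_intros tendsto_mult_left_zero tendsto_zero_orbit q qq_nz) 

text \<open>For \<open>y n = e ^ n / qpoch q q n\<close> the number \<open>qpoch q q k * conv y k 0\<close> is the continuous
  \<open>q\<close>-Hermite polynomial \<open>H\<^sub>k\<close> at \<open>(e + 1 / e) / 2\<close>.\<close>

lemma L_power: "L (\<lambda>w. w ^ k) = qpoch q q k * mass * conv (\<lambda>n. e ^ n / qpoch q q n) k 0"
proof -
  define y where "y n = e ^ n / qpoch q q n" for n
  \<comment> \<open>The orbit starts at 1/e, where \<open>L_qlin_inverse\<close> gives the value,
    and ends at 0, where \<open>qlin\<close> is a monomial. The defect \<open>z\<close> is zero at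
    the start, hence throughout.\<close>
  define z where "z k n = L (qlin (1 / e * q ^ n) q k) / qpoch q q k - mass * conv y k (1 / e * q ^ n)" for k n
  have "z k n = 0" for k n
  proof (rule orbit_zero_from_start[of z "\<lambda>n. 1 / e * q ^ n"])
    have q0: "qlin x q 0 = (\<lambda>_. 1)" for x by auto
    show "z 0 n = z 0 (Suc n)" for n by (simp add: z_def q0)
    show "z k 0 = 0" for k
    proof -
      \<comment> \<open>Here \<alpha> e = 1, so the shifted factorial starts with the factor 1 - 1
        and the convolution collapses to one term.\<close>
      have "u (Suc m) (1 / e) = 0" for m by (simp add: u_def)
      then have "conv y k (1 / e) = y k"
        unfolding conv_def by (cases k) (simp_all add: sum.atMost_Suc_shift del: sum.atMost_Suc)
      then show ?thesis by (simp add: z_def L_qlin_inverse y_def)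
    qed
    show "z (Suc k) n = z (Suc k) (Suc n) - 1 / e * q ^ n * z k (Suc n)" for k n
    proof -
      define b where "b = 1 / e * q ^ n"
      have "L (qlin b q (Suc k)) = L (qlin (b * q) q (Suc k)) - b * (1 - q ^ Suc k) * L (qlin (b * q) q k)"
        unfolding qlin_orbit[of b, abs_def] by (simp add: L_diff L_cmult continuous_intros)
      moreover have "qpoch q q (Suc k) = qpoch q q k * (1 - q ^ Suc k)" by (simp add: qpoch_Suc)
      ultimately have "L (qlin b q (Suc k)) / qpoch q q (Suc k) = L (qlin (b * q) q (Suc k)) / qpoch q q (Suc k)
          - b * (L (qlin (b * q) q k) / qpoch q q k)"
        using q_power_ne_1[of k] by (simp add: diff_divide_distrib)
      moreover have "b * q = 1 / e * q ^ Suc n" by (simp add: b_def)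
      ultimately show ?thesis
        unfolding z_def b_def[symmetric] conv_orbit[of y k b] by (simp add: algebra_simps)
    qed
  qed
  then have "(\<lambda>n. L (qlin (1 / e * q ^ n) q k) / qpoch q q k) = (\<lambda>n. mass * conv y k (1 / e * q ^ n))"
    by (auto simp: z_def fun_eq_iff)
  moreover have "(\<lambda>n. mass * conv y k (1 / e * q ^ n)) \<longlonglongrightarrow> mass * conv y k 0"
    by (intro tendsto_intros conv_tendsto)
  moreover have "(\<lambda>n. L (qlin (1 / e * q ^ n) q k) / qpoch q q k) \<longlonglongrightarrow> L (qlin 0 q k) / qpoch q q k"
    by (intro tendsto_intros L_tendsto[where r = "cmod (1 / e)"] tendsto_zero_orbit q orbit_in_cball qq_nz)
      (auto simp: split_beta intro!: continuous_intros)
  ultimately have "L (qlin 0 q k) / qpoch q q k = mass * conv y k 0"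
    using LIMSEQ_unique by metis
  moreover have "qlin 0 q k = (\<lambda>w. w ^ k)" by auto
  ultimately show ?thesis unfolding y_def by (simp add: field_simps)
qed

end

subsection \<open>Products of shifted factorials under the functional\<close>

text \<open>The Gaussian binomial coefficient. The value 0 for n > N makes the Pascal rule hold for
  all n and lets sums run one index further.\<close>

definition qbin :: "complex \<Rightarrow> nat \<Rightarrow> nat \<Rightarrow> complex" where
  "qbin q N n = (if n \<le> N then qpoch q q N / (qpoch q q n * qpoch q q (N - n)) else 0)"

lemma qbin_0 [simp]: "cmod q < 1 \<Longrightarrow> qbin q N 0 = 1"
  using qpoch_qq_nonzero[of q N] by (simp add: qbin_def)

lemma qbin_pascal:
  assumes q: "cmod q < 1"
  shows "qbin q (Suc N) (Suc n) = q ^ Suc n * qbin q N (Suc n) + qbin q N n"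
proof -
  note nz = qpoch_qq_nonzero[OF q]
  have nz1: "1 - q ^ Suc m \<noteq> 0" for m
    using nz[of "Suc m"] by (auto simp: qpoch_Suc)
  consider "n < N" | "n = N" | "N < n" by linarith
  then show ?thesis
  proof cases
    case 1
    then obtain m where N: "N = Suc (n + m)" by (auto dest: less_imp_Suc_add)
    have e: "Suc N - Suc n = Suc m" "N - Suc n = m" "N - n = Suc m" by (auto simp: N)
    have a1: "qpoch q q (Suc N) = qpoch q q N * (1 - q ^ Suc n * q ^ Suc m)"
      by (simp add: qpoch_Suc N power_add mult_ac)
    have a2: "qpoch q q (Suc n) = qpoch q q n * (1 - q ^ Suc n)" "qpoch q q (Suc m) = qpoch q q m * (1 - q ^ Suc m)"
      by (simp_all add: qpoch_Suc)
    \<comment> \<open>The Pascal rule comes down to 1 - x y = x (1 - y) + (1 - x), with x = q^(n+1)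
      and y = q^(m+1).\<close>
    have *: "P * (1 - x * y) / (A * (1 - x) * (B * (1 - y))) = x * (P / (A * (1 - x) * B)) + P / (A * (B * (1 - y)))"
      if "A \<noteq> 0" "B \<noteq> 0" "1 - x \<noteq> 0" "1 - y \<noteq> 0" for P x y A B :: complex
      using that by (simp add: divide_simps) (simp add: algebra_simps)
    show ?thesis
      using 1 unfolding qbin_def e a1 a2 by (simp only: less_imp_le Suc_leI Suc_le_mono if_True *[OF nz nz nz1 nz1])
  next
    case 2
    then show ?thesis using nz nz1 by (simp add: qbin_def)
  qed (simp add: qbin_def)
qed

text \<open>The terminating \<open>q\<close>-Chu--Vandermonde sum, homogenized so that no parameter is inverted;
  \<open>qlin d q n 0\<close> is \<open>(-d) ^ n q ^ (n choose 2)\<close>.\<close>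

lemma qlin_vandermonde_aux:
  assumes q: "cmod q < 1"
  shows "qlin d q N w = (\<Sum>n\<le>N. qbin q N n * (qlin d q n 0 * qpoch (a * w) q n * qpoch (a * d * q ^ n) q (N - n) * w ^ (N - n)))"
proof (induction N arbitrary: d)
  case 0
  then show ?case using q by simp
next
  case (Suc N)
  define S where "S n = qlin d q n 0 * qpoch (a * w) q n * qpoch (a * d * q ^ n) q (Suc N - n) * w ^ (Suc N - n)" for n
  have sc: "qlin (d * q) q n 0 = q ^ n * qlin d q n 0" for n
    by (induction n) (simp_all add: qlin_Suc)
  \<comment> \<open>The induction peels off the first factor, leaving the parameter d q. It rests on
    w - d = w (1 - a d q^n) - d (1 - a w q^n); the two resulting sums recombine by
    \<open>qbin_pascal\<close>.\<close>
  have split: "(w - d) * (qbin q N n * (qlin (d * q) q n 0 * qpoch (a * w) q n * qpoch (a * (d * q) * q ^ n) q (N - n) * w ^ (N - n)))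
      = q ^ n * qbin q N n * S n + qbin q N n * S (Suc n)" if "n \<le> N" for n
  proof -
    have 1: "S n = qlin d q n 0 * qpoch (a * w) q n * ((1 - a * d * q ^ n) * qpoch (a * (d * q) * q ^ n) q (N - n)) * (w * w ^ (N - n))"
      using that by (simp add: S_def Suc_diff_le qpoch_Suc_left mult_ac)
    have 2: "S (Suc n) = (- d * (q ^ n * qlin d q n 0)) * (qpoch (a * w) q n * (1 - a * w * q ^ n)) * qpoch (a * (d * q) * q ^ n) q (N - n) * w ^ (N - n)"
      by (simp add: S_def qpoch_Suc[of _ q n] qlin_Suc_left[of d q n 0] sc mult_ac)
    show ?thesis unfolding 1 2 sc by (simp add: algebra_simps)
  qed
  have "qlin d q (Suc N) w = (\<Sum>n\<le>N. q ^ n * qbin q N n * S n + qbin q N n * S (Suc n))"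
    unfolding qlin_Suc_left Suc sum_distrib_left by (intro sum.cong refl split) simp
  also have "\<dots> = (\<Sum>n\<le>Suc N. q ^ n * qbin q N n * S n) + (\<Sum>n\<le>N. qbin q N n * S (Suc n))"
    by (simp add: sum.distrib qbin_def)
  also have "\<dots> = (\<Sum>n\<le>Suc N. qbin q (Suc N) n * S n)"
    using q by (simp add: sum.atMost_Suc_shift qbin_pascal distrib_right distrib_left sum.distrib mult_ac del: sum.atMost_Suc power_Suc)
  finally show ?case by (simp only: S_def)
qed

lemma qlin_vandermonde:
  assumes q: "cmod q < 1" and ad: "\<And>n. qpoch (a * d) q n \<noteq> 0"
  shows "qlin d q N w / (qpoch q q N * qpoch (a * d) q N) =
    (\<Sum>n\<le>N. qlin d q n 0 * qpoch (a * w) q n / (qpoch q q n * qpoch (a * d) q n) * (w ^ (N - n) / qpoch q q (N - n)))"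
  unfolding qlin_vandermonde_aux[OF q, of d N w a] sum_divide_distrib
proof (intro sum.cong refl)
  fix n assume "n \<in> {..N}"
  then have n: "n \<le> N" by simp
  have s: "qpoch (a * d) q N = qpoch (a * d) q n * qpoch (a * d * q ^ n) q (N - n)"
    using qpoch_add[of "a * d" q n "N - n"] n by simp
  have nz: "qpoch (a * d) q n \<noteq> 0" "qpoch (a * d * q ^ n) q (N - n) \<noteq> 0"
    using ad[of N] unfolding s by auto
  show "qbin q N n * (qlin d q n 0 * qpoch (a * w) q n * qpoch (a * d * q ^ n) q (N - n) * w ^ (N - n)) / (qpoch q q N * qpoch (a * d) q N)
    = qlin d q n 0 * qpoch (a * w) q n / (qpoch q q n * qpoch (a * d) q n) * (w ^ (N - n) / qpoch q q (N - n))"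
    unfolding s using n nz qpoch_qq_nonzero[OF q] by (simp add: qbin_def divide_simps)
qed

section \<open>The case d = 0 and its recursion in the first parameter\<close>

context qkernel
begin

text \<open>This is |x| < 1/\<rho>, which keeps (x w; q)_\<infinity> free of zeros for |w| < \<rho>;
  as \<rho> > 1, it also implies |x| < 1.\<close>

definition small :: "complex \<Rightarrow> bool" where "small x \<longleftrightarrow> cmod x * \<rho> < 1"

lemma small_mult: "small x \<Longrightarrow> cmod w < \<rho> \<Longrightarrow> cmod (x * w) < 1"
  unfolding small_def by (smt (verit) mult_left_mono norm_ge_zero norm_mult)

lemma small_less_1: "small x \<Longrightarrow> cmod x < 1"
  using small_mult[of x 1] R by simp

lemma small_e: "small x \<Longrightarrow> cmod (x * e) < 1" "small x \<Longrightarrow> cmod (x / e) < 1"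
  using small_less_1[of x] e by (auto simp: norm_mult norm_divide)

lemma small_small: "small x \<Longrightarrow> small y \<Longrightarrow> cmod (x * y) < 1"
  using small_mult[of x y] small_less_1[of y] R by simp

lemma small_orbit: "small x \<Longrightarrow> small (x * q ^ n)"
proof -
  have "cmod (x * q ^ n) * \<rho> \<le> cmod x * \<rho>"
    using orbit_in_cball[of x n] R by (intro mult_right_mono) auto
  then show "small x \<Longrightarrow> small (x * q ^ n)" by (simp add: small_def)
qed

lemma small_cball: "small x \<Longrightarrow> y \<in> cball 0 (cmod x) \<Longrightarrow> small y"
  unfolding small_def using R by (smt (verit) mem_cball_0 mult_right_mono)

lemma small_q: "small x \<Longrightarrow> small (x * q)"
  using small_orbit[of x 1] by simp

lemma small_0 [simp]: "small 0"
  by (simp add: small_def)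

lemma qpoch_inf_nz: "cmod x < 1 \<Longrightarrow> qpoch_inf x q \<noteq> 0"
  by (rule qpoch_inf_nonzero[OF q(2)])

text \<open>The coefficient of t^k in the integrand without \<open>kern\<close>, at d = 0. The
  denominator (\<alpha> b c w; q)_k has been absorbed into the infinite product, whence the shift by
  q^k.\<close>

definition G :: "nat \<Rightarrow> complex \<Rightarrow> complex \<Rightarrow> complex \<Rightarrow> complex \<Rightarrow> complex" where
  "G k \<alpha> b c w = qpoch (\<alpha> * b) q k * qpoch (\<alpha> * c) q k / qpoch q q k * w ^ k * qpoch_inf (\<alpha> * b * c * w * q ^ k) q
     / (qpoch_inf (\<alpha> * w) q * qpoch_inf (b * w) q * qpoch_inf (c * w) q)"

lemma holomorphic_G:
  assumes "small \<alpha>" "small b" "small c"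
  shows "G k \<alpha> b c holomorphic_on ball 0 \<rho>"
  unfolding G_def by (intro holomorphic_intros q) (use assms in \<open>auto intro!: qpoch_inf_nz small_mult\<close>)

lemma continuous_G:
  assumes "small \<alpha>" "small b" "small c"
  shows "continuous_on (sphere 0 R) (G k \<alpha> b c)"
  by (rule continuous_on_sphere_scale(1)[OF holomorphic_G[OF assms]])

text \<open>The integrand that \<open>L_recurrence'\<close> produces from
  \<open>G k \<alpha> b c\<close> is a combination of \<open>G\<close> at \<alpha> q. All terms
  share a factor built from infinite products, and a rational identity remains.\<close>

lemma G_orbit:
  assumes sm: "small \<alpha>" "small b" "small c" and w: "cmod w = R"
  shows "(1 + \<alpha>\<^sup>2 - \<alpha> * w) * G k \<alpha> b c w - \<alpha> * (G k \<alpha> b c w - G k \<alpha> b c (q * w)) / w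
    = (1 - \<alpha> * b) * (1 - \<alpha> * c) * (G k (\<alpha> * q) b c w - \<alpha> * (if k = 0 then 0 else G (k - 1) (\<alpha> * q) b c w))"
proof -
  define Q where "Q = q ^ k"
  define X where "X = qpoch_inf (\<alpha> * b * c * w * Q * q) q"
  define A B C where "A = qpoch_inf (\<alpha> * w * q) q" and "B = qpoch_inf (b * w * q) q" and "C = qpoch_inf (c * w * q) q"
  define K where "K = qpoch (\<alpha> * b) q k * qpoch (\<alpha> * c) q k / qpoch q q k * w ^ k"
  have w0: "w \<noteq> 0" and wr: "cmod w < \<rho>" using w R by auto
  have eA: "qpoch_inf (\<alpha> * w) q = (1 - \<alpha> * w) * A" and eB: "qpoch_inf (b * w) q = (1 - b * w) * B"
    and eC: "qpoch_inf (c * w) q = (1 - c * w) * C"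
    unfolding A_def B_def C_def by (rule qpoch_inf_Suc[OF q(2)])+
  have eX: "qpoch_inf (\<alpha> * b * c * w * Q) q = (1 - \<alpha> * b * c * w * Q) * X"
    unfolding X_def by (rule qpoch_inf_Suc[OF q(2)])
  have "qpoch_inf (\<alpha> * w) q \<noteq> 0" "qpoch_inf (b * w) q \<noteq> 0" "qpoch_inf (c * w) q \<noteq> 0"
    using sm wr by (auto intro!: qpoch_inf_nz small_mult)
  then have nz: "1 - \<alpha> * w \<noteq> 0" "1 - b * w \<noteq> 0" "1 - c * w \<noteq> 0" "A \<noteq> 0" "B \<noteq> 0" "C \<noteq> 0"
    unfolding eA eB eC by auto
  \<comment> \<open>The common factor of all terms; what remains beside it is polynomial up to
    1/w.\<close>
  define Z where "Z = K * X / (A * (1 - b * w) * B * (1 - c * w) * C * (1 - \<alpha> * w))"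
  have g1: "G k \<alpha> b c w = Z * (1 - \<alpha> * b * c * w * Q)"
    unfolding G_def eA eB eC Q_def[symmetric] eX Z_def K_def by (simp add: mult_ac)
  have "G k \<alpha> b c (q * w) = K * Q * X / (A * B * C)"
    unfolding G_def K_def X_def A_def B_def C_def Q_def by (simp add: power_mult_distrib mult_ac)
  also have "\<dots> = Z * Q * (1 - \<alpha> * w) * (1 - b * w) * (1 - c * w)"
    unfolding Z_def using nz by (simp add: divide_simps)
  finally have g2: "G k \<alpha> b c (q * w) = Z * Q * (1 - \<alpha> * w) * (1 - b * w) * (1 - c * w)" .
  have front: "(1 - \<alpha> * x) * qpoch (\<alpha> * q * x) q j = qpoch (\<alpha> * x) q j * (1 - \<alpha> * x * q ^ j)" for x j
    using qpoch_Suc[of "\<alpha> * x" q j] by (simp add: qpoch_Suc_left mult_ac)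
  have "(1 - \<alpha> * b) * (1 - \<alpha> * c) * G k (\<alpha> * q) b c w = ((1 - \<alpha> * b) * qpoch (\<alpha> * q * b) q k) * ((1 - \<alpha> * c) * qpoch (\<alpha> * q * c) q k)
      / qpoch q q k * w ^ k * X / (A * ((1 - b * w) * B) * ((1 - c * w) * C))"
    unfolding G_def eB[symmetric] eC[symmetric] X_def A_def Q_def by (simp add: mult_ac)
  also have "\<dots> = K * X / (A * ((1 - b * w) * B) * ((1 - c * w) * C)) * ((1 - \<alpha> * b * Q) * (1 - \<alpha> * c * Q))"
    unfolding front K_def Q_def by (simp add: mult_ac)
  also have "\<dots> = Z * (1 - \<alpha> * w) * ((1 - \<alpha> * b * Q) * (1 - \<alpha> * c * Q))"
    unfolding Z_def using nz by (simp add: divide_simps)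
  finally have g3: "(1 - \<alpha> * b) * (1 - \<alpha> * c) * G k (\<alpha> * q) b c w = Z * (1 - \<alpha> * w) * ((1 - \<alpha> * b * Q) * (1 - \<alpha> * c * Q))" .
  \<comment> \<open>At k = 0 the right-hand side vanishes because Q = 1, so one formula covers both
    branches.\<close>
  have g4: "(1 - \<alpha> * b) * (1 - \<alpha> * c) * (if k = 0 then 0 else G (k - 1) (\<alpha> * q) b c w)
     = Z * (1 - Q) * (1 - \<alpha> * b * c * w * Q) * (1 - \<alpha> * w) / w"
  proof (cases k)
    case 0
    then show ?thesis by (simp add: Q_def)
  next
    case (Suc j)
    have sh: "\<alpha> * q * b * c * w * q ^ j = \<alpha> * b * c * w * Q" by (simp add: Q_def Suc)
    have qk: "qpoch q q k = qpoch q q j * (1 - Q)" by (simp add: Suc qpoch_Suc Q_def)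
    have Q1: "1 - Q \<noteq> 0" using q_power_ne_1[of j] by (simp add: Q_def Suc)
    have "(1 - \<alpha> * b) * (1 - \<alpha> * c) * G j (\<alpha> * q) b c w = (qpoch (\<alpha> * b) q k) * (qpoch (\<alpha> * c) q k)
        / qpoch q q j * w ^ j * ((1 - \<alpha> * b * c * w * Q) * X) / (A * ((1 - b * w) * B) * ((1 - c * w) * C))"
      unfolding G_def eB[symmetric] eC[symmetric] sh eX A_def Suc qpoch_Suc_left[of "\<alpha> * b"] qpoch_Suc_left[of "\<alpha> * c"]
      by (simp add: mult_ac)
    also have "\<dots> = K * X / (A * ((1 - b * w) * B) * ((1 - c * w) * C)) * (1 - Q) * (1 - \<alpha> * b * c * w * Q) / w"
      unfolding K_def qk using Q1 w0 by (simp add: Suc divide_simps)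
    also have "\<dots> = Z * (1 - Q) * (1 - \<alpha> * b * c * w * Q) * (1 - \<alpha> * w) / w"
      unfolding Z_def using nz by (simp add: divide_simps)
    finally show ?thesis by (simp add: Suc)
  qed
  have "(1 - \<alpha> * b) * (1 - \<alpha> * c) * (G k (\<alpha> * q) b c w - \<alpha> * (if k = 0 then 0 else G (k - 1) (\<alpha> * q) b c w))
    = (1 - \<alpha> * b) * (1 - \<alpha> * c) * G k (\<alpha> * q) b c w - \<alpha> * ((1 - \<alpha> * b) * (1 - \<alpha> * c) * (if k = 0 then 0 else G (k - 1) (\<alpha> * q) b c w))"
    by (simp only: right_diff_distrib mult_ac)
  also have "\<dots> = Z * ((1 - \<alpha> * w) * ((1 - \<alpha> * b * Q) * (1 - \<alpha> * c * Q)) - \<alpha> * ((1 - Q) * (1 - \<alpha> * b * c * w * Q) * (1 - \<alpha> * w) / w))"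
  proof -
    have "Z * x * y - \<alpha> * (Z * p * r * s / w) = Z * (x * y - \<alpha> * (p * r * s / w))" for x y p r s
      by (simp add: right_diff_distrib mult_ac)
    then show ?thesis unfolding g3 g4 .
  qed
  also have "(1 - \<alpha> * w) * ((1 - \<alpha> * b * Q) * (1 - \<alpha> * c * Q)) - \<alpha> * ((1 - Q) * (1 - \<alpha> * b * c * w * Q) * (1 - \<alpha> * w) / w)
    = (1 + \<alpha>\<^sup>2 - \<alpha> * w) * (1 - \<alpha> * b * c * w * Q) - \<alpha> * ((1 - \<alpha> * b * c * w * Q) - Q * (1 - \<alpha> * w) * (1 - b * w) * (1 - c * w)) / w"
    using w0 by (simp add: divide_simps) (simp add: algebra_simps power2_eq_square)
  also have "Z * \<dots> = (1 + \<alpha>\<^sup>2 - \<alpha> * w) * G k \<alpha> b c w - \<alpha> * (G k \<alpha> b c w - G k \<alpha> b c (q * w)) / w"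
    unfolding g1 g2 by (simp add: algebra_simps diff_divide_distrib)
  finally show ?thesis ..
qed

definition E :: "complex \<Rightarrow> complex" where
  "E x = qpoch_inf (x * e) q * qpoch_inf (x / e) q"

lemma E_nz: "small x \<Longrightarrow> E x \<noteq> 0"
  unfolding E_def using small_e qpoch_inf_nz by simp

lemma E_0 [simp]: "E 0 = 1"
  by (simp add: E_def)

lemma E_Suc: "E x = (1 - x * e) * (1 - x / e) * E (x * q)"
  unfolding E_def using qpoch_inf_Suc[OF q(2), of "x * e"] qpoch_inf_Suc[OF q(2), of "x / e"]
  by (simp add: mult_ac)

lemma E_split: "E x = qpoch (x * e) q n * qpoch (x / e) q n * E (x * q ^ n)"
  unfolding E_def using qpoch_inf_split[OF q(2), of "x * e" n] qpoch_inf_split[OF q(2), of "x / e" n]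
  by (simp add: mult_ac)

text \<open>Normalized so that the factors (1 - \<alpha> e)(1 - \<alpha>/e) and (1 - \<alpha> b)(1 -
  \<alpha> c) of the recursion are absorbed, leaving that of the orbit lemmas. The normalizing
  factors tend to 1 as \<alpha> tends to 0.\<close>

definition V :: "nat \<Rightarrow> complex \<Rightarrow> complex \<Rightarrow> complex \<Rightarrow> complex" where
  "V k \<alpha> b c = L (G k \<alpha> b c) * E \<alpha> / (qpoch_inf (\<alpha> * b) q * qpoch_inf (\<alpha> * c) q)"

lemma V_orbit:
  assumes sm: "small \<alpha>" "small b" "small c"
  shows "V k \<alpha> b c = V k (\<alpha> * q) b c - \<alpha> * (if k = 0 then 0 else V (k - 1) (\<alpha> * q) b c)"
proof -
  have smq: "small (\<alpha> * q)" using sm(1) by (rule small_q)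
  have "(1 - \<alpha> * e) * (1 - \<alpha> / e) * L (G k \<alpha> b c) 
    = L (\<lambda>w. (1 + \<alpha>\<^sup>2 - \<alpha> * w) * G k \<alpha> b c w - \<alpha> * (G k \<alpha> b c w - G k \<alpha> b c (q * w)) / w)"
    by (rule L_recurrence'[OF holomorphic_G[OF sm]])
  also have "\<dots> = L (\<lambda>w. (1 - \<alpha> * b) * (1 - \<alpha> * c) * (G k (\<alpha> * q) b c w - \<alpha> * (if k = 0 then 0 else G (k - 1) (\<alpha> * q) b c w)))"
    by (rule L_cong) (rule G_orbit[OF sm])
  also have "\<dots> = (1 - \<alpha> * b) * (1 - \<alpha> * c) * (L (G k (\<alpha> * q) b c) - \<alpha> * (if k = 0 then 0 else L (G (k - 1) (\<alpha> * q) b c)))"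
    by (cases "k = 0") (simp_all add: L_cmult L_diff continuous_G smq sm continuous_intros)
  finally have *: "(1 - \<alpha> * e) * (1 - \<alpha> / e) * L (G k \<alpha> b c) = \<dots>" .
  have pb: "qpoch_inf (\<alpha> * x) q = (1 - \<alpha> * x) * qpoch_inf (\<alpha> * q * x) q" for x
    using qpoch_inf_Suc[OF q(2), of "\<alpha> * x"] by (simp add: mult_ac)
  have nz: "1 - \<alpha> * b \<noteq> 0" "1 - \<alpha> * c \<noteq> 0"
    using pb[of b] pb[of c] qpoch_inf_nz[OF small_small[OF sm(1) sm(2)]] qpoch_inf_nz[OF small_small[OF sm(1) sm(3)]] by auto
  have "V k \<alpha> b c = ((1 - \<alpha> * e) * (1 - \<alpha> / e) * L (G k \<alpha> b c)) * E (\<alpha> * q) / (qpoch_inf (\<alpha> * b) q * qpoch_inf (\<alpha> * c) q)"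
    unfolding V_def E_Suc[of \<alpha>] by (simp add: mult_ac)
  also have "\<dots> = (L (G k (\<alpha> * q) b c) - \<alpha> * (if k = 0 then 0 else L (G (k - 1) (\<alpha> * q) b c))) * E (\<alpha> * q) 
       / (qpoch_inf (\<alpha> * q * b) q * qpoch_inf (\<alpha> * q * c) q)"
    unfolding * pb[of b] pb[of c] using nz by (simp add: mult_ac)
  also have "\<dots> = V k (\<alpha> * q) b c - \<alpha> * (if k = 0 then 0 else V (k - 1) (\<alpha> * q) b c)"
    unfolding V_def by (simp add: left_diff_distrib diff_divide_distrib)
  finally show ?thesis .
qed

lemma V_tendsto:
  assumes sm: "small \<alpha>" "small b" "small c"
  shows "(\<lambda>n. V k (\<alpha> * q ^ n) b c) \<longlonglongrightarrow> L (G k 0 b c)"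
proof -
  have "continuous_on (cball 0 (cmod \<alpha>) \<times> sphere 0 R) (\<lambda>(x, w). G k x b c w)"
    unfolding G_def split_beta
    by (intro continuous_intros q ballI) (use R sm small_cball[OF sm(1)] in \<open>auto intro!: qpoch_inf_nz small_mult\<close>)
  then have "(\<lambda>n. L (G k (\<alpha> * q ^ n) b c)) \<longlonglongrightarrow> L (G k 0 b c)"
    by (rule L_tendsto[where h = "\<lambda>x. G k x b c"]) (intro tendsto_zero_orbit q orbit_in_cball)+
  then have "(\<lambda>n. V k (\<alpha> * q ^ n) b c) \<longlonglongrightarrow> L (G k 0 b c) * (qpoch_inf (0 * e) q * qpoch_inf (0 / e) q) / (qpoch_inf (0 * b) q * qpoch_inf (0 * c) q)"
    unfolding V_def E_def by (intro tendsto_intros tendsto_zero_orbit q) auto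
  then show ?thesis by simp
qed

text \<open>Restores the parameter \<alpha>: \<open>V\<close> and \<open>K * conv y\<close> obey the
  same recursion along \<alpha> q^n and have the same limit by hypothesis.\<close>

lemma L_G_from_zero:
  assumes sm: "small \<alpha>" "small b" "small c"
    and zero: "\<And>k. L (G k 0 b c) = K * conv y k 0"
  shows "L (G k \<alpha> b c) = qpoch_inf (\<alpha> * b) q * qpoch_inf (\<alpha> * c) q / E \<alpha> * K * conv y k \<alpha>"
proof -
  define z where "z k n = V k (\<alpha> * q ^ n) b c - K * conv y k (\<alpha> * q ^ n)" for k n
  have "z k 0 = 0"
  proof (rule orbit_zero_from_limit[of z "\<lambda>n. \<alpha> * q ^ n"])
    have s: "\<alpha> * q ^ n * q = \<alpha> * q ^ Suc n" for n by simp
    show "z 0 n = z 0 (Suc n)" for n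
      using V_orbit[OF small_orbit[OF sm(1)] sm(2,3), of 0 n] by (simp add: z_def mult_ac)
    show "z (Suc k) n = z (Suc k) (Suc n) - \<alpha> * q ^ n * z k (Suc n)" for k n
      unfolding z_def conv_orbit[of y k "\<alpha> * q ^ n"] V_orbit[OF small_orbit[OF sm(1)] sm(2,3), of "Suc k" n] s
      by (simp add: algebra_simps)
    have "z k \<longlonglongrightarrow> L (G k 0 b c) - K * conv y k 0" for k
      unfolding z_def by (intro tendsto_intros V_tendsto sm conv_tendsto)
    then show "z k \<longlonglongrightarrow> 0" for k by (simp add: zero)
  qed
  then have "V k \<alpha> b c = K * conv y k \<alpha>" by (simp add: z_def)
  moreover have "qpoch_inf (\<alpha> * b) q \<noteq> 0" "qpoch_inf (\<alpha> * c) q \<noteq> 0" "E \<alpha> \<noteq> 0"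
    using sm by (auto intro!: qpoch_inf_nz small_small E_nz)
  ultimately show ?thesis unfolding V_def by (simp add: field_simps)
qed

section \<open>The coefficient of t^k for general d\<close>

definition F :: "nat \<Rightarrow> complex \<Rightarrow> complex \<Rightarrow> complex \<Rightarrow> complex \<Rightarrow> complex \<Rightarrow> complex" where
  "F k a d b c w = qpoch (a * b) q k * qpoch (a * c) q k / (qpoch q q k * qpoch (a * d) q k) * qlin d q k w
     * qpoch_inf (a * b * c * w * q ^ k) q / (qpoch_inf (a * w) q * qpoch_inf (b * w) q * qpoch_inf (c * w) q)"

text \<open>\<open>qlin_vandermonde\<close> expands the factor containing d in the products w^(k-n)
  (a w; q)_n, and each (a w; q)_n cancels the beginning of (a w; q)_\<infinity>, which shifts a to a
  q^n.\<close>

lemma F_eq_sum_G: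
  assumes sm: "small a" "small b" "small c" and ad: "cmod (a * d) < 1" and w: "cmod w = R"
  shows "F k a d b c w = (\<Sum>n\<le>k. qlin d q n 0 * qpoch (a * b) q n * qpoch (a * c) q n / (qpoch q q n * qpoch (a * d) q n)
       * G (k - n) (a * q ^ n) b c w)"
proof -
  define M where "M = qpoch (a * b) q k * qpoch (a * c) q k * qpoch_inf (a * b * c * w * q ^ k) q / (qpoch_inf (a * w) q * qpoch_inf (b * w) q * qpoch_inf (c * w) q)"
  have "F k a d b c w = M * (qlin d q k w / (qpoch q q k * qpoch (a * d) q k))"
    by (simp add: F_def M_def mult_ac)
  also have "\<dots> = (\<Sum>n\<le>k. M * (qlin d q n 0 * qpoch (a * w) q n / (qpoch q q n * qpoch (a * d) q n) * (w ^ (k - n) / qpoch q q (k - n))))"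
    unfolding qlin_vandermonde[OF q(2) qpoch_nonzero[OF q(2) ad]] sum_distrib_left ..
  also have "\<dots> = (\<Sum>n\<le>k. qlin d q n 0 * qpoch (a * b) q n * qpoch (a * c) q n / (qpoch q q n * qpoch (a * d) q n)
       * G (k - n) (a * q ^ n) b c w)"
  proof (intro sum.cong refl)
    fix n assume "n \<in> {..k}"
    then have n: "n \<le> k" by simp
    have s: "qpoch (a * x) q k = qpoch (a * x) q n * qpoch (a * q ^ n * x) q (k - n)" for x
      using qpoch_add[of "a * x" q n "k - n"] n by (simp add: mult_ac)
    have i: "qpoch_inf (a * w) q = qpoch (a * w) q n * qpoch_inf (a * q ^ n * w) q"
      using qpoch_inf_split[OF q(2), of "a * w" n] by (simp add: mult_ac)
    have "qpoch_inf (a * w) q \<noteq> 0" using sm w R by (auto intro!: qpoch_inf_nz small_mult)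
    then have nz: "qpoch (a * w) q n \<noteq> 0" unfolding i by auto
    have p: "a * q ^ n * b * c * w * q ^ (k - n) = a * b * c * w * q ^ k"
      using n by (simp add: mult_ac flip: power_add)
    show "M * (qlin d q n 0 * qpoch (a * w) q n / (qpoch q q n * qpoch (a * d) q n) * (w ^ (k - n) / qpoch q q (k - n)))
      = qlin d q n 0 * qpoch (a * b) q n * qpoch (a * c) q n / (qpoch q q n * qpoch (a * d) q n) * G (k - n) (a * q ^ n) b c w"
      unfolding M_def G_def p s[of b] s[of c] i using nz by (simp add: mult_ac)
  qed
  finally show ?thesis .
qed

text \<open>Applying \<open>L\<close> to \<open>F_eq_sum_G\<close> gives a double sum; regrouped,
  its inner sum is again of Chu-Vandermonde type. The data \<open>K\<close> and \<open>y\<close>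
  must be the same for all points a q^n of the orbit.\<close>

lemma L_F_from_G:
  assumes sm: "small a" "small b" "small c" and ad: "cmod (a * d) < 1"
    and LG: "\<And>j n. L (G j (a * q ^ n) b c) = qpoch_inf (a * q ^ n * b) q * qpoch_inf (a * q ^ n * c) q / E (a * q ^ n) * K * conv y j (a * q ^ n)"
  shows "L (F k a d b c) = qpoch_inf (a * b) q * qpoch_inf (a * c) q / E a * K *
    (\<Sum>m\<le>k. qpoch (a * e) q m * qpoch (d * e) q m / (qpoch q q m * qpoch (a * d) q m) * (1 / e) ^ m * y (k - m))"
proof -
  define B where "B = qpoch_inf (a * b) q * qpoch_inf (a * c) q / E a * K"
  define X where "X n = qlin d q n 0 * (qpoch (a * e) q n * qpoch (a / e) q n) / (qpoch q q n * qpoch (a * d) q n)" for n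
  have "L (F k a d b c) = L (\<lambda>w. \<Sum>n\<le>k. qlin d q n 0 * qpoch (a * b) q n * qpoch (a * c) q n / (qpoch q q n * qpoch (a * d) q n)
       * G (k - n) (a * q ^ n) b c w)"
    by (rule L_cong) (rule F_eq_sum_G[OF sm ad])
  also have "\<dots> = (\<Sum>n\<le>k. qlin d q n 0 * qpoch (a * b) q n * qpoch (a * c) q n / (qpoch q q n * qpoch (a * d) q n)
       * L (G (k - n) (a * q ^ n) b c))"
    by (subst L_sum) (auto simp only: L_cmult intro!: continuous_on_mult continuous_on_const continuous_G small_orbit sm)
  also have "\<dots> = (\<Sum>n\<le>k. B * (X n * conv y (k - n) (a * q ^ n)))"
  proof (intro sum.cong refl)
    fix n
    have i: "qpoch_inf (a * x) q = qpoch (a * x) q n * qpoch_inf (a * q ^ n * x) q" for x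
      using qpoch_inf_split[OF q(2), of "a * x" n] by (simp add: mult_ac)
    have "E (a * q ^ n) \<noteq> 0" "E a \<noteq> 0" using sm by (auto intro!: E_nz small_orbit)
    then have "qpoch (a * e) q n \<noteq> 0" "qpoch (a / e) q n \<noteq> 0" using E_split[of a n] by auto
    then show "qlin d q n 0 * qpoch (a * b) q n * qpoch (a * c) q n / (qpoch q q n * qpoch (a * d) q n) * L (G (k - n) (a * q ^ n) b c)
      = B * (X n * conv y (k - n) (a * q ^ n))"
      unfolding LG B_def X_def i[of b] i[of c] E_split[of a n] by (simp add: mult_ac)
  qed
  also have "\<dots> = B * (\<Sum>n\<le>k. \<Sum>m\<le>k - n. X n * (u m (a * q ^ n) * y (k - n - m)))"
    unfolding conv_def by (simp add: sum_distrib_left)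
  also have "(\<Sum>n\<le>k. \<Sum>m\<le>k - n. X n * (u m (a * q ^ n) * y (k - n - m))) 
      = (\<Sum>(n, m)\<in>{(n, m). n + m \<le> k}. X n * (u m (a * q ^ n) * y (k - n - m)))"
    by (subst sum.Sigma) (auto intro!: sum.cong)
  \<comment> \<open>With N = n + m the factor \<open>y\<close> depends on N only, so the sum over n
    can be evaluated.\<close>
  also have "\<dots> = (\<Sum>N\<le>k. \<Sum>n\<le>N. X n * (u (N - n) (a * q ^ n) * y (k - n - (N - n))))"
    by (rule sum.triangle_reindex_eq)
  also have "\<dots> = (\<Sum>N\<le>k. qpoch (a * e) q N * qpoch (d * e) q N / (qpoch q q N * qpoch (a * d) q N) * (1 / e) ^ N * y (k - N))"
  proof (intro sum.cong refl)
    fix N assume "N \<in> {..k}"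
    have "(\<Sum>n\<le>N. X n * (u (N - n) (a * q ^ n) * y (k - n - (N - n))))
      = (\<Sum>n\<le>N. qpoch (a * e) q N * y (k - N) * (qlin d q n 0 * qpoch (a * (1 / e)) q n / (qpoch q q n * qpoch (a * d) q n) * ((1 / e) ^ (N - n) / qpoch q q (N - n))))"
    proof (intro sum.cong refl)
      fix n assume "n \<in> {..N}"
      then have n: "n \<le> N" by simp
      have s: "qpoch (a * e) q N = qpoch (a * e) q n * qpoch (a * q ^ n * e) q (N - n)"
        using qpoch_add[of "a * e" q n "N - n"] n by (simp add: mult_ac)
      have k: "k - n - (N - n) = k - N" using n by simp
      show "X n * (u (N - n) (a * q ^ n) * y (k - n - (N - n))) = qpoch (a * e) q N * y (k - N) * (qlin d q n 0 * qpoch (a * (1 / e)) q n / (qpoch q q n * qpoch (a * d) q n) * ((1 / e) ^ (N - n) / qpoch q q (N - n)))"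
        unfolding k s X_def u_def by (simp add: mult_ac)
    qed
    \<comment> \<open>\<open>qlin_vandermonde\<close> read from right to left at w = 1/e, where
      \<open>qlin\<close> is e^(-N) (d e; q)_N.\<close>
    also have "\<dots> = qpoch (a * e) q N * y (k - N) * (qlin d q N (1 / e) / (qpoch q q N * qpoch (a * d) q N))"
      unfolding qlin_vandermonde[OF q(2) qpoch_nonzero[OF q(2) ad]] sum_distrib_left ..
    also have "\<dots> = qpoch (a * e) q N * qpoch (d * e) q N / (qpoch q q N * qpoch (a * d) q N) * (1 / e) ^ N * y (k - N)"
      by (simp add: qlin_qpoch mult_ac)
    finally show "(\<Sum>n\<le>N. X n * (u (N - n) (a * q ^ n) * y (k - n - (N - n))))
      = qpoch (a * e) q N * qpoch (d * e) q N / (qpoch q q N * qpoch (a * d) q N) * (1 / e) ^ N * y (k - N)" .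
  qed
  finally show ?thesis unfolding B_def .
qed

text \<open>Trades the denominator (b w; q)_\<infinity> for the polynomial
  \<open>qlin b q k w\<close>. Suitably normalized, both sides obey the same recursion along b q^n
  and share the limit \<open>L (G k 0 c 0)\<close>, whose value need not be known.\<close>

lemma L_G_two:
  assumes sm: "small b" "small c"
  shows "L (G k b c 0) = qpoch_inf (b * c) q / E b * (L (\<lambda>w. qlin b q k w / qpoch_inf (c * w) q) / qpoch q q k)"
proof -
  define x where "x k \<beta> = L (\<lambda>w. qlin \<beta> q k w / qpoch_inf (c * w) q) / qpoch q q k" for k \<beta>
  have cw: "qpoch_inf (c * w) q \<noteq> 0" if "cmod w = R" for w
    using that sm R by (intro qpoch_inf_nz small_mult) auto
  have cont: "continuous_on (sphere 0 R) (\<lambda>w. qlin \<beta> q k w / qpoch_inf (c * w) q)" for \<beta> k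
    by (intro continuous_intros q) (use cw in auto)
  define z where "z k n = V k (b * q ^ n) c 0 - x k (b * q ^ n)" for k n
  have "z k 0 = 0"
  proof (rule orbit_zero_from_limit[of z "\<lambda>n. b * q ^ n"])
    have s: "b * q ^ n * q = b * q ^ Suc n" for n by simp
    show "z 0 n = z 0 (Suc n)" for n
      using V_orbit[OF small_orbit[OF sm(1)] sm(2) small_0, of 0 n] by (simp add: z_def x_def mult_ac)
    show "z (Suc k) n = z (Suc k) (Suc n) - b * q ^ n * z k (Suc n)" for k n
    proof -
      define \<beta> where "\<beta> = b * q ^ n"
      have "L (\<lambda>w. qlin \<beta> q (Suc k) w / qpoch_inf (c * w) q) 
         = L (\<lambda>w. qlin (\<beta> * q) q (Suc k) w / qpoch_inf (c * w) q - \<beta> * (1 - q ^ Suc k) * (qlin (\<beta> * q) q k w / qpoch_inf (c * w) q))"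
        unfolding qlin_orbit[of \<beta>] by (simp add: diff_divide_distrib)
      also have "\<dots> = L (\<lambda>w. qlin (\<beta> * q) q (Suc k) w / qpoch_inf (c * w) q) - \<beta> * (1 - q ^ Suc k) * L (\<lambda>w. qlin (\<beta> * q) q k w / qpoch_inf (c * w) q)"
        by (subst L_diff) (auto simp only: L_cmult intro!: cont continuous_on_mult continuous_on_const)
      finally have "x (Suc k) \<beta> = x (Suc k) (\<beta> * q) - \<beta> * x k (\<beta> * q)"
        unfolding x_def using q_power_ne_1[of k] by (simp add: qpoch_Suc[of q q k] diff_divide_distrib)
      then show ?thesis
        unfolding z_def V_orbit[OF small_orbit[OF sm(1)] sm(2) small_0, of "Suc k" n] s \<beta>_def by (simp add: algebra_simps)
    qed
    fix k
    have "continuous_on (cball 0 (cmod b) \<times> sphere 0 R) (\<lambda>(\<beta>, w). qlin \<beta> q k w / qpoch_inf (c * w) q)"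
      unfolding split_beta by (intro continuous_intros q) (use cw in auto)
    then have "(\<lambda>n. L (\<lambda>w. qlin (b * q ^ n) q k w / qpoch_inf (c * w) q)) \<longlonglongrightarrow> L (\<lambda>w. qlin 0 q k w / qpoch_inf (c * w) q)"
      by (rule L_tendsto[where h = "\<lambda>\<beta> w. qlin \<beta> q k w / qpoch_inf (c * w) q"]) (intro tendsto_zero_orbit q orbit_in_cball)+
    then have "(\<lambda>n. x k (b * q ^ n)) \<longlonglongrightarrow> x k 0"
      unfolding x_def by (intro tendsto_intros) auto
    moreover have "x k 0 = L (G k 0 c 0)"
    proof -
      have "G k 0 c 0 = (\<lambda>w. 1 / qpoch q q k * (qlin 0 q k w / qpoch_inf (c * w) q))"
        by (auto simp: G_def)
      then show ?thesis unfolding x_def by (simp only: L_cmult) simp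
    qed
    ultimately have "z k \<longlonglongrightarrow> L (G k 0 c 0) - L (G k 0 c 0)"
      unfolding z_def by (intro tendsto_diff V_tendsto sm small_0) simp
    then show "z k \<longlonglongrightarrow> 0" by simp
  qed
  then have "V k b c 0 = x k b" by (simp add: z_def)
  moreover have "qpoch_inf (b * c) q \<noteq> 0" "E b \<noteq> 0"
    using sm by (auto intro!: qpoch_inf_nz small_small E_nz)
  ultimately show ?thesis unfolding V_def x_def by (simp add: field_simps)
qed

text \<open>Up to constants, \<open>L_G_two\<close> turns the left-hand side into
  \<open>L (F k c b 0 0)\<close>, and this is evaluated by \<open>L_F_from_G\<close>.\<close>

lemma L_G_zero_aux:
  assumes sm: "small b" "small c"
  shows "L (G k 0 b c) = qpoch_inf (b * c) q / (E b * E c) * mass *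
    (\<Sum>m\<le>k. qpoch (c * e) q m * qpoch (b * e) q m / (qpoch q q m * qpoch (b * c) q m) * (1 / e) ^ m * (e ^ (k - m) / qpoch q q (k - m)))"
proof -
  define y where "y n = e ^ n / qpoch q q n" for n
  have bc: "cmod (c * b) < 1" using sm by (intro small_small)
  \<comment> \<open>With all parameters zero only a monomial is left, so \<open>L_power\<close>
    supplies the initial data.\<close>
  have "G k 0 0 0 = (\<lambda>w. 1 / qpoch q q k * w ^ k)" for k by (auto simp: G_def)
  then have z: "L (G k 0 0 0) = mass * conv y k 0" for k
    by (simp only: L_cmult L_power) (simp add: y_def[abs_def])
  have 1: "L (F k c b 0 0) = qpoch_inf (c * 0) q * qpoch_inf (c * 0) q / E c * mass *
    (\<Sum>m\<le>k. qpoch (c * e) q m * qpoch (b * e) q m / (qpoch q q m * qpoch (c * b) q m) * (1 / e) ^ m * y (k - m))"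
    by (rule L_F_from_G[OF sm(2) small_0 small_0 bc L_G_from_zero[OF small_orbit[OF sm(2)] small_0 small_0 z]])
  have nz: "qpoch (c * b) q k \<noteq> 0" using bc q by (intro qpoch_nonzero)
  \<comment> \<open>Here c takes the place of a, and b that of d.\<close>
  have "F k c b 0 0 = (\<lambda>w. 1 / (qpoch q q k * qpoch (c * b) q k) * (qlin b q k w / qpoch_inf (c * w) q))"
    by (auto simp: F_def)
  then have 2: "L (F k c b 0 0) = 1 / (qpoch q q k * qpoch (c * b) q k) * L (\<lambda>w. qlin b q k w / qpoch_inf (c * w) q)"
    by (simp only: L_cmult)
  have "G k b c 0 = (\<lambda>w. qpoch (c * b) q k * G k 0 b c w)"
    by (auto simp: G_def mult_ac)
  then have 3: "L (G k b c 0) = qpoch (c * b) q k * L (G k 0 b c)"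
    by (simp only: L_cmult)
  have "L (G k 0 b c) = qpoch_inf (b * c) q / E b * L (F k c b 0 0)"
  proof -
    have "L (G k 0 b c) = L (G k b c 0) / qpoch (c * b) q k" using nz 3 by simp
    also have "\<dots> = qpoch_inf (b * c) q / E b * L (F k c b 0 0)"
      unfolding 2 L_G_two[OF sm] by (simp add: mult_ac)
    finally show ?thesis .
  qed
  then show ?thesis unfolding 1 y_def by (simp add: mult_ac)
qed

text \<open>The kernel, \<open>L\<close>, \<open>E\<close> and \<open>mass\<close> are invariant
  under e -> 1/e. The previous evaluation, taken at 1/e, has b and c paired with 1/e, as the second
  series of the theorem demands.\<close>

lemma L_G_zero:
  assumes sm: "small b" "small c"
  shows "L (G k 0 b c) = qpoch_inf (b * c) q / (E b * E c) * mass *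
    conv (\<lambda>n. qpoch (b / e) q n * qpoch (c / e) q n / (qpoch q q n * qpoch (b * c) q n) * e ^ n) k 0"
proof -
  interpret inv: qkernel q "1 / e" p R \<rho>
    by unfold_locales (use q e p R in \<open>auto simp: norm_divide\<close>)
  have kern: "inv.kern = kern" by (auto simp: inv.kern_def kern_def mult.commute)
  have L: "inv.L = L" by (auto simp: inv.L_def L_def kern)
  have E: "inv.E = E" by (auto simp: inv.E_def E_def mult.commute)
  have mass: "inv.mass = mass" by (simp add: inv.mass_def mass_def L)
  have "L (G k 0 b c) = qpoch_inf (b * c) q / (E b * E c) * mass *
    (\<Sum>m\<le>k. qpoch (c / e) q m * qpoch (b / e) q m / (qpoch q q m * qpoch (b * c) q m) * e ^ m * ((1 / e) ^ (k - m) / qpoch q q (k - m)))"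
    using inv.L_G_zero_aux[OF sm, of k, unfolded L E mass] by simp
  \<comment> \<open>Reversal of the summation order; at \<alpha> = 0 the weight \<open>u m\<close>
    is (1/e)^m / (q; q)_m.\<close>
  also have "(\<Sum>m\<le>k. qpoch (c / e) q m * qpoch (b / e) q m / (qpoch q q m * qpoch (b * c) q m) * e ^ m * ((1 / e) ^ (k - m) / qpoch q q (k - m)))
     = conv (\<lambda>n. qpoch (b / e) q n * qpoch (c / e) q n / (qpoch q q n * qpoch (b * c) q n) * e ^ n) k 0"
    unfolding conv_def u_def
    by (rule sum.reindex_bij_witness[of _ "\<lambda>m. k - m" "\<lambda>m. k - m"]) (auto simp: mult_ac)
  finally show ?thesis .
qed

text \<open>The value at a = d = 0 is lifted to a by \<open>L_G_from_zero\<close> and then to d by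
  \<open>L_F_from_G\<close>. The sum is the k-th Cauchy coefficient of the two series of the
  theorem.\<close>

lemma L_F:
  assumes sm: "small a" "small b" "small c" and d: "cmod d < 1"
  shows "L (F k a d b c) = mass * (qpoch_inf (a * b) q * qpoch_inf (a * c) q * qpoch_inf (b * c) q / (E a * E b * E c)) *
    (\<Sum>m\<le>k. qpoch (a * e) q m * qpoch (d * e) q m / (qpoch q q m * qpoch (a * d) q m) * (1 / e) ^ m *
      (qpoch (b / e) q (k - m) * qpoch (c / e) q (k - m) / (qpoch q q (k - m) * qpoch (b * c) q (k - m)) * e ^ (k - m)))"
proof -
  have "cmod a * cmod d < 1 * 1" using small_less_1[OF sm(1)] d by (intro mult_strict_mono) auto
  then have ad: "cmod (a * d) < 1" by (simp add: norm_mult)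
  show ?thesis
    unfolding L_F_from_G[OF sm ad L_G_from_zero[OF small_orbit[OF sm(1)] sm(2,3) L_G_zero[OF sm(2,3)]]]
    by (simp add: mult_ac)
qed

end

subsection \<open>Summation over \<open>k\<close>\<close>

text \<open>Factorwise comparison with the convergent product for (-1; |q|)_k gives one constant for
  all k and all |x| \<le> 1.\<close>

lemma qpoch_bounded:
  assumes "cmod q < 1"
  obtains B where "\<And>x k. cmod x \<le> 1 \<Longrightarrow> cmod (qpoch x q k) \<le> B" "\<And>x. cmod x \<le> 1 \<Longrightarrow> cmod (qpoch_inf x q) \<le> B"
proof -
  have "convergent (\<lambda>k. qpoch (-1) (of_real (cmod q)) k)"
    using qpoch_tendsto[of "of_real (cmod q)" "-1"] assms by (auto simp: convergent_def)
  then have "Bseq (\<lambda>k. qpoch (-1) (of_real (cmod q)) k)" by (rule convergent_imp_Bseq)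
  then obtain B where B: "\<And>k. cmod (qpoch (-1) (of_real (cmod q)) k) \<le> B"
    by (auto simp: Bseq_def)
  have 1: "cmod (qpoch x q k) \<le> B" if "cmod x \<le> 1" for x k
  proof -
    have "cmod (qpoch x q k) = (\<Prod>j<k. cmod (1 - x * q ^ j))"
      by (simp add: qpoch_def prod_norm)
    also have "\<dots> \<le> (\<Prod>j<k. cmod (1 + of_real (cmod q) ^ j))"
    proof (intro prod_mono conjI norm_ge_zero)
      fix j
      have "cmod (1 - x * q ^ j) \<le> 1 + cmod x * cmod q ^ j"
        by (metis norm_mult norm_one norm_power norm_triangle_ineq4)
      also have "\<dots> \<le> 1 + cmod q ^ j" using that by (simp add: mult_left_le_one_le)
      also have "\<dots> = cmod (of_real (1 + cmod q ^ j))" unfolding norm_of_real by simp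
      also have "\<dots> = cmod (1 + of_real (cmod q) ^ j)" by simp
      finally show "cmod (1 - x * q ^ j) \<le> cmod (1 + of_real (cmod q) ^ j)" .
    qed
    also have "\<dots> = cmod (qpoch (-1) (of_real (cmod q)) k)"
      by (simp add: qpoch_def prod_norm)
    finally show ?thesis using B[of k] by simp
  qed
  have "cmod (qpoch_inf x q) \<le> B" if "cmod x \<le> 1" for x
    by (rule tendsto_upperbound[OF tendsto_norm[OF qpoch_tendsto[OF assms]]]) (use 1[OF that] in auto)
  with 1 show ?thesis using that by blast
qed

text \<open>The quotient converges, since the infinite products in the denominator do not
  vanish.\<close>

lemma qpoch_quotient_bounded:
  assumes "cmod q < 1" "cmod z < 1"
  obtains B where "0 \<le> B" "\<And>k. cmod (qpoch x q k * qpoch y q k / (qpoch q q k * qpoch z q k)) \<le> B"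
proof -
  have "(\<lambda>k. qpoch x q k * qpoch y q k / (qpoch q q k * qpoch z q k)) \<longlonglongrightarrow> qpoch_inf x q * qpoch_inf y q / (qpoch_inf q q * qpoch_inf z q)"
    by (intro tendsto_intros qpoch_tendsto assms) (use qpoch_inf_nonzero assms in auto)
  then have "Bseq (\<lambda>k. qpoch x q k * qpoch y q k / (qpoch q q k * qpoch z q k))"
    by (intro convergent_imp_Bseq) (auto simp: convergent_def)
  then show ?thesis using that unfolding Bseq_def by (meson less_imp_le)
qed

lemma summable_norm_phi21:
  assumes "cmod q < 1" "cmod z < 1" "cmod s < 1"
  shows "summable (\<lambda>k. cmod (qpoch x q k * qpoch y q k / (qpoch q q k * qpoch z q k) * s ^ k))"
proof -
  obtain B where B: "0 \<le> B" "\<And>k. cmod (qpoch x q k * qpoch y q k / (qpoch q q k * qpoch z q k)) \<le> B"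
    using qpoch_quotient_bounded[OF assms(1,2)] by metis
  show ?thesis
  proof (rule summable_comparison_test')
    show "summable (\<lambda>k. B * cmod s ^ k)" using assms(3) by (intro summable_mult summable_geometric) simp
    have "cmod (qpoch x q k * qpoch y q k / (qpoch q q k * qpoch z q k) * s ^ k) \<le> B * cmod s ^ k" for k
      unfolding norm_mult[of _ "s ^ k"] norm_power by (intro mult_right_mono B) simp
    then show "norm (cmod (qpoch x q k * qpoch y q k / (qpoch q q k * qpoch z q k) * s ^ k)) \<le> B * cmod s ^ k" for k
      by (simp only: real_norm_def abs_norm_cancel)
  qed
qed

context qkernel
begin

text \<open>All factors except (t w)^k are bounded uniformly in k and w; for \<open>qlin\<close>
  this uses |d/w| \<le> 1 once w^k has been taken out.\<close>

lemma kern_F_bound: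
  assumes sm: "small a" "small b" "small c" and d: "cmod d < 1"
  obtains C where "\<And>k w. cmod w = R \<Longrightarrow> cmod (kern w * (t ^ k * F k a d b c w)) \<le> C * (cmod t * R) ^ k"
proof -
  have "cmod a * cmod d < 1 * 1" using small_less_1[OF sm(1)] d by (intro mult_strict_mono) auto
  then have ad: "cmod (a * d) < 1" by (simp add: norm_mult)
  obtain B1 where B1: "0 \<le> B1" "\<And>k. cmod (qpoch (a * b) q k * qpoch (a * c) q k / (qpoch q q k * qpoch (a * d) q k)) \<le> B1"
    using qpoch_quotient_bounded[OF q(2) ad] by metis
  obtain B2 where B2: "\<And>x k. cmod x \<le> 1 \<Longrightarrow> cmod (qpoch x q k) \<le> B2" "\<And>x. cmod x \<le> 1 \<Longrightarrow> cmod (qpoch_inf x q) \<le> B2"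
    using qpoch_bounded[OF q(2)] by metis
  have B2': "0 \<le> B2" using order_trans[OF norm_ge_zero B2(2)[of 0]] by simp
  define h where "h w = kern w / (qpoch_inf (a * w) q * qpoch_inf (b * w) q * qpoch_inf (c * w) q)" for w
  have "continuous_on (sphere 0 R) h"
    unfolding h_def by (intro continuous_intros continuous_on_kern q) (use sm R in \<open>auto intro!: qpoch_inf_nz small_mult\<close>)
  then have "compact (h ` sphere 0 R)" by (intro compact_continuous_image) auto
  then obtain B3 where "\<forall>w\<in>sphere 0 R. cmod (h w) \<le> B3"
    by (auto dest!: compact_imp_bounded simp: bounded_iff)
  then have B3: "cmod (h w) \<le> B3" if "cmod w = R" for w using that by simp
  show ?thesis
  proof (rule that)
    fix k w assume w: "cmod w = R"
    then have w0: "w \<noteq> 0" and wr: "cmod w < \<rho>" using R by auto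
    have "cmod (d / w) \<le> 1" using d w R by (simp add: norm_divide divide_simps)
    then have 1: "cmod (qpoch (d / w) q k) \<le> B2" by (rule B2)
    have "cmod (a * b * c * w * q ^ k) = cmod (a * b) * cmod (c * w) * cmod q ^ k"
      by (simp add: norm_mult norm_power)
    also have "\<dots> \<le> 1 * 1 * 1"
      using small_small[OF sm(1,2)] small_mult[OF sm(3) wr] q
      by (intro mult_mono power_le_one) (auto intro: less_imp_le)
    finally have 2: "cmod (qpoch_inf (a * b * c * w * q ^ k) q) \<le> B2" by (intro B2) simp
    have "kern w * (t ^ k * F k a d b c w) = h w * (qpoch (a * b) q k * qpoch (a * c) q k / (qpoch q q k * qpoch (a * d) q k))
       * qpoch (d / w) q k * qpoch_inf (a * b * c * w * q ^ k) q * (t * w) ^ k"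
      unfolding F_def h_def qlin_qpoch[OF w0] by (simp add: power_mult_distrib mult_ac)
    also have "cmod \<dots> \<le> B3 * B1 * B2 * B2 * (cmod t * R) ^ k"
      unfolding norm_mult[of _ "_ ^ k"] norm_mult[of _ "qpoch_inf _ _"] norm_mult[of _ "qpoch _ _ _"] norm_mult[of "h _"] 
        norm_power norm_mult[of t] w
      using B1 B2' order_trans[OF norm_ge_zero B3[OF w]] R
      by (intro mult_mono B3 B1 1 2 w order_refl mult_nonneg_nonneg norm_ge_zero zero_le_power) auto
    finally show "cmod (kern w * (t ^ k * F k a d b c w)) \<le> B3 * B1 * B2 * B2 * (cmod t * R) ^ k" .
  qed
qed

lemma continuous_F:
  assumes sm: "small a" "small b" "small c" and ad: "cmod (a * d) < 1"
  shows "continuous_on (sphere 0 R) (F k a d b c)"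
  unfolding F_def
  by (intro continuous_intros q) (use sm R qpoch_nonzero[OF q(2) ad] in \<open>auto intro!: qpoch_inf_nz small_mult\<close>)

text \<open>Integral and sum are interchanged by a Weierstrass test with the geometric majorant of
  \<open>kern_F_bound\<close>.\<close>

lemma L_F_series:
  assumes sm: "small a" "small b" "small c" and d: "cmod d < 1" and t: "cmod t * R < 1"
  shows "(\<lambda>k. t ^ k * L (F k a d b c)) sums
      integral {-pi..pi} (\<lambda>\<psi>. \<Sum>k. kern (of_real R * cis \<psi>) * (t ^ k * F k a d b c (of_real R * cis \<psi>)))"
    and "cmod w = R \<Longrightarrow> summable (\<lambda>k. kern w * (t ^ k * F k a d b c w))"
proof -
  have "cmod a * cmod d < 1 * 1" using small_less_1[OF sm(1)] d by (intro mult_strict_mono) auto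
  then have ad: "cmod (a * d) < 1" by (simp add: norm_mult)
  obtain C where C: "\<And>k w. cmod w = R \<Longrightarrow> cmod (kern w * (t ^ k * F k a d b c w)) \<le> C * (cmod t * R) ^ k"
    using kern_F_bound[OF sm d] by metis
  have S: "summable (\<lambda>k. C * (cmod t * R) ^ k)"
    using t R by (intro summable_mult summable_geometric) simp
  show "summable (\<lambda>k. kern w * (t ^ k * F k a d b c w))" if "cmod w = R" for w
    by (rule summable_comparison_test'[OF S C[OF that]])
  define f where "f k \<psi> = kern (of_real R * cis \<psi>) * (t ^ k * F k a d b c (of_real R * cis \<psi>))" for k \<psi>
  have int: "f k integrable_on {-pi..pi}" and cont: "continuous_on {-pi..pi} (f k)" for k
  proof -
    have "continuous_on (sphere 0 (cmod (of_real R))) (\<lambda>w. kern w * (t ^ k * F k a d b c w))"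
      using R by (auto intro!: continuous_intros continuous_on_kern continuous_F sm ad)
    then show "continuous_on {-pi..pi} (f k)" unfolding f_def by (rule continuous_on_circle)
    then show "f k integrable_on {-pi..pi}" by (rule integrable_continuous_real)
  qed
  have "uniform_limit {-pi..pi} (\<lambda>n \<psi>. \<Sum>k<n. f k \<psi>) (\<lambda>\<psi>. \<Sum>k. f k \<psi>) sequentially"
  proof (rule Weierstrass_m_test[OF _ S])
    show "cmod (f k \<psi>) \<le> C * (cmod t * R) ^ k" for k \<psi>
      unfolding f_def by (rule C) (use R in \<open>simp add: norm_mult\<close>)
  qed
  then obtain I J where IJ: "\<And>n. ((\<lambda>\<psi>. \<Sum>k<n. f k \<psi>) has_integral I n) {-pi..pi}"
      "((\<lambda>\<psi>. \<Sum>k. f k \<psi>) has_integral J) {-pi..pi}" "I \<longlonglongrightarrow> J"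
    by (rule uniform_limit_integral) (auto intro!: continuous_intros cont)
  have "I n = (\<Sum>k<n. t ^ k * L (F k a d b c))" for n
  proof -
    have "I n = (\<Sum>k<n. integral {-pi..pi} (f k))"
      by (rule has_integral_unique[OF IJ(1)]) (intro has_integral_sum integrable_integral int, simp)
    also have "\<dots> = (\<Sum>k<n. t ^ k * L (F k a d b c))"
      unfolding L_def f_def by (simp add: mult.left_commute[of _ "t ^ _"])
    finally show ?thesis .
  qed
  then have "I = (\<lambda>n. \<Sum>k<n. t ^ k * L (F k a d b c))" by blast
  moreover have "J = integral {-pi..pi} (\<lambda>\<psi>. \<Sum>k. f k \<psi>)" using IJ(2) by (simp add: integral_unique)
  ultimately show "(\<lambda>k. t ^ k * L (F k a d b c)) sums
      integral {-pi..pi} (\<lambda>\<psi>. \<Sum>k. kern (of_real R * cis \<psi>) * (t ^ k * F k a d b c (of_real R * cis \<psi>)))"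
    using IJ(3) unfolding sums_def f_def by simp
qed

lemma kern_phi32:
  assumes sm: "small a" "small b" "small c" and d: "cmod d < 1" and t: "cmod t * R < 1" and w: "cmod w = R"
  shows "kern w * (qpoch_inf (a * b * c * w) q / (qpoch_inf (a * w) q * qpoch_inf (b * w) q * qpoch_inf (c * w) q)
      * qphi [d / w, a * b, a * c] [a * b * c * w, a * d] q (t * w)) = (\<Sum>k. kern w * (t ^ k * F k a d b c w))"
proof -
  have w0: "w \<noteq> 0" and wr: "cmod w < \<rho>" using w R by auto
  define g where "g k = qpoch (d / w) q k * (qpoch (a * b) q k * qpoch (a * c) q k) / (qpoch q q k * (qpoch (a * b * c * w) q k * qpoch (a * d) q k)) * (t * w) ^ k" for k
  define M where "M = qpoch_inf (a * b * c * w) q / (qpoch_inf (a * w) q * qpoch_inf (b * w) q * qpoch_inf (c * w) q)"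
  have "cmod (a * b) * cmod (c * w) < 1 * 1"
    using small_small[OF sm(1,2)] small_mult[OF sm(3) wr] by (intro mult_strict_mono) auto
  then have abc: "cmod (a * b * c * w) < 1" by (simp add: norm_mult mult.assoc)
  have eq: "t ^ k * F k a d b c w = M * g k" for k
    using qpoch_inf_split[OF q(2), of "a * b * c * w" k] qpoch_nonzero[OF q(2) abc, of k]
    by (simp add: F_def g_def M_def qlin_qpoch[OF w0] power_mult_distrib mult_ac)
  have M: "M \<noteq> 0" unfolding M_def using abc sm wr by (auto intro!: qpoch_inf_nz small_mult)
  show ?thesis
  \<comment> \<open>Summability is known only for the series multiplied by \<open>kern w\<close>; at
    a zero of the kernel both sides are 0.\<close>
  proof (cases "kern w = 0")
    case False
    with M have "summable g"
      using L_F_series(2)[OF sm d t w] unfolding eq by (simp add: mult.assoc[symmetric] summable_cmult_iff)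
    moreover have "qphi [d / w, a * b, a * c] [a * b * c * w, a * d] q (t * w) = (\<Sum>k. g k)"
      unfolding qphi_def g_def by simp
    ultimately show ?thesis
      unfolding eq M_def[symmetric] by (simp add: suminf_mult mult.assoc)
  qed simp
qed

text \<open>One power series in t is summed twice: termwise integration gives the integral, while
  \<open>L_F\<close> identifies its terms as those of a Cauchy product.\<close>

lemma kern_phi32_integral:
  assumes sm: "small a" "small b" "small c" and d: "cmod d < 1" and t: "cmod t * R < 1"
  shows "integral {-pi..pi} (\<lambda>\<psi>. let w = of_real R * cis \<psi> in
      kern w * (qpoch_inf (a * b * c * w) q / (qpoch_inf (a * w) q * qpoch_inf (b * w) q * qpoch_inf (c * w) q)
      * qphi [d / w, a * b, a * c] [a * b * c * w, a * d] q (t * w))) = 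
    mass * (qpoch_inf (a * b) q * qpoch_inf (a * c) q * qpoch_inf (b * c) q / (E a * E b * E c))
      * (qphi [a * e, d * e] [a * d] q (t / e) * qphi [b / e, c / e] [b * c] q (t * e))"
proof -
  have "cmod a * cmod d < 1 * 1" using small_less_1[OF sm(1)] d by (intro mult_strict_mono) auto
  then have ad: "cmod (a * d) < 1" by (simp add: norm_mult)
  have "cmod t \<le> cmod t * R" using R by (simp add: mult_left_le mult_le_cancel_left1)
  then have t1: "cmod t < 1" using t by simp
  define A where "A m = qpoch (a * e) q m * qpoch (d * e) q m / (qpoch q q m * qpoch (a * d) q m) * (t / e) ^ m" for m
  define B where "B n = qpoch (b / e) q n * qpoch (c / e) q n / (qpoch q q n * qpoch (b * c) q n) * (t * e) ^ n" for n
  define M where "M = mass * (qpoch_inf (a * b) q * qpoch_inf (a * c) q * qpoch_inf (b * c) q / (E a * E b * E c))"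
  have term_eq: "t ^ k * L (F k a d b c) = M * (\<Sum>m\<le>k. A m * B (k - m))" for k
  proof -
    have "t ^ k * L (F k a d b c) = M * (\<Sum>m\<le>k. t ^ k * (qpoch (a * e) q m * qpoch (d * e) q m / (qpoch q q m * qpoch (a * d) q m) * (1 / e) ^ m *
      (qpoch (b / e) q (k - m) * qpoch (c / e) q (k - m) / (qpoch q q (k - m) * qpoch (b * c) q (k - m)) * e ^ (k - m))))"
      unfolding L_F[OF sm d] M_def sum_distrib_left[symmetric] by (simp add: mult_ac)
    also have "\<dots> = M * (\<Sum>m\<le>k. A m * B (k - m))"
    proof (intro arg_cong[where f = "\<lambda>x. M * x"] sum.cong refl)
      fix m assume "m \<in> {..k}"
      then have "t ^ k = t ^ m * t ^ (k - m)" by (simp flip: power_add)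
      then show "t ^ k * (qpoch (a * e) q m * qpoch (d * e) q m / (qpoch q q m * qpoch (a * d) q m) * (1 / e) ^ m *
        (qpoch (b / e) q (k - m) * qpoch (c / e) q (k - m) / (qpoch q q (k - m) * qpoch (b * c) q (k - m)) * e ^ (k - m))) = A m * B (k - m)"
        by (simp add: A_def B_def power_mult_distrib power_divide mult_ac)
    qed
    finally show ?thesis .
  qed
  have "summable (\<lambda>k. cmod (A k))" unfolding A_def
    by (rule summable_norm_phi21) (use q ad t1 e in \<open>auto simp: norm_divide\<close>)
  moreover have "summable (\<lambda>k. cmod (B k))" unfolding B_def
    by (rule summable_norm_phi21) (use q small_small[OF sm(2,3)] t1 e in \<open>auto simp: norm_mult\<close>)
  ultimately have "(\<lambda>k. \<Sum>m\<le>k. A m * B (k - m)) sums ((\<Sum>k. A k) * (\<Sum>k. B k))"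
    by (rule Cauchy_product_sums)
  then have S: "(\<lambda>k. t ^ k * L (F k a d b c)) sums (M * ((\<Sum>k. A k) * (\<Sum>k. B k)))"
    unfolding term_eq by (rule sums_mult)
  have AB: "(\<Sum>k. A k) = qphi [a * e, d * e] [a * d] q (t / e)" "(\<Sum>k. B k) = qphi [b / e, c / e] [b * c] q (t * e)"
    unfolding qphi_def A_def B_def by simp_all
  have "integral {-pi..pi} (\<lambda>\<psi>. let w = of_real R * cis \<psi> in
      kern w * (qpoch_inf (a * b * c * w) q / (qpoch_inf (a * w) q * qpoch_inf (b * w) q * qpoch_inf (c * w) q)
      * qphi [d / w, a * b, a * c] [a * b * c * w, a * d] q (t * w)))
    = integral {-pi..pi} (\<lambda>\<psi>. \<Sum>k. kern (of_real R * cis \<psi>) * (t ^ k * F k a d b c (of_real R * cis \<psi>)))"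
    unfolding Let_def
    by (intro integral_cong kern_phi32 sm d t) (use R in \<open>simp add: norm_mult\<close>)
  also have "\<dots> = M * ((\<Sum>k. A k) * (\<Sum>k. B k))"
    by (rule sums_unique2[OF L_F_series(1)[OF sm d t] S])
  finally show ?thesis unfolding AB M_def .
qed

end

section \<open>Return to the variables z = \<sigma> w, e = exp(i \<theta>) and p = f e\<close>

theorem theorem3p3:
  fixes q a b c d t f :: complex and \<sigma> \<theta> :: real
  assumes hq: "0 < cmod q" "cmod q < 1"
    and hnz: "a \<noteq> 0" "b \<noteq> 0" "c \<noteq> 0" "d \<noteq> 0" "t \<noteq> 0" "f \<noteq> 0"
    and hsig: "0 < \<sigma>" "\<sigma> < 1"
    and habc: "cmod a < \<sigma>" "cmod b < \<sigma>" "cmod c < \<sigma>"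
    and hd: "cmod d < 1" and ht: "cmod t < \<sigma>"
    and hth: "0 \<le> \<theta>" "\<theta> \<le> pi"
    and hf: "\<forall>m::int. f \<noteq> q powi m"
    and hf2: "\<forall>m::int. f * exp (2 * \<i> * \<theta>) \<noteq> q powi m"
    and hgen: "a * d \<notin> Omega_q q" "b * c \<notin> Omega_q q"
  shows "integral {-pi..pi} (\<lambda>\<psi>::real.
            let z = exp (\<i> * \<psi>);
                e = exp (\<i> * \<theta>)
            in qpochs_inf [f * e * \<sigma> / z, q / f / e * \<sigma> / z,
                           f * e * z / \<sigma>, q / f / e * z / \<sigma>, a * b * c * z / \<sigma>] q
               / qpochs_inf [e * \<sigma> / z, \<sigma> / (e * z), a * z / \<sigma>, b * z / \<sigma>, c * z / \<sigma>] q
               * qphi [d * \<sigma> / z, a * b, a * c] [a * b * c * z / \<sigma>, a * d] q (t * z / \<sigma>))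
       = (let e = exp (\<i> * \<theta>) in
           2 * pi * qtheta f q * qtheta (f * e ^ 2) q * qpochs_inf [a * b, a * c, b * c] q
           / qpochs_inf [q, a * e, a / e, b * e, b / e, c * e, c / e] q
           * qphi [a * e, d * e] [a * d] q (t / e)
           * qphi [b / e, c / e] [b * c] q (t * e))"
proof -
  define e where "e = exp (\<i> * of_real \<theta>)"
  \<comment> \<open>The midpoint between the largest of |a|, |b|, |c| and \<sigma>: then \<rho> =
    1/s exceeds R = 1/\<sigma>, while a, b and c remain \<open>small\<close>.\<close>
  define s where "s = (max (cmod a) (max (cmod b) (cmod c)) + \<sigma>) / 2"
  have s: "cmod a < s" "cmod b < s" "cmod c < s" "s < \<sigma>"
    using habc unfolding s_def by (auto simp: max_def)
  then have "0 < s" by (meson norm_ge_zero le_less_trans)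
  interpret qkernel q e "f * e" "1 / \<sigma>" "1 / s"
    by unfold_locales (use hq hnz hsig s \<open>0 < s\<close> in \<open>auto simp: e_def divide_simps\<close>)
  have sm: "small a" "small b" "small c"
    using s \<open>0 < s\<close> by (auto simp: small_def)
  have t: "cmod t * (1 / \<sigma>) < 1" using ht hsig by simp
  have integrand: "(let z = exp (\<i> * of_real \<psi>)
            in qpochs_inf [f * e * \<sigma> / z, q / f / e * \<sigma> / z,
                           f * e * z / \<sigma>, q / f / e * z / \<sigma>, a * b * c * z / \<sigma>] q
               / qpochs_inf [e * \<sigma> / z, \<sigma> / (e * z), a * z / \<sigma>, b * z / \<sigma>, c * z / \<sigma>] q
               * qphi [d * \<sigma> / z, a * b, a * c] [a * b * c * z / \<sigma>, a * d] q (t * z / \<sigma>))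
    = (let w = of_real (1 / \<sigma>) * cis \<psi> in
      kern w * (qpoch_inf (a * b * c * w) q / (qpoch_inf (a * w) q * qpoch_inf (b * w) q * qpoch_inf (c * w) q)
      * qphi [d / w, a * b, a * c] [a * b * c * w, a * d] q (t * w)))" for \<psi> :: real
  proof -
    define w where "w = of_real (1 / \<sigma>) * cis \<psi>"
    have z: "exp (\<i> * of_real \<psi>) = of_real \<sigma> * w"
      using hsig by (simp add: w_def cis_conv_exp)
    have x: "x * (of_real \<sigma> * w) / of_real \<sigma> = x * w" "x * of_real \<sigma> / (of_real \<sigma> * w) = x / w"
        "of_real \<sigma> / (e * (of_real \<sigma> * w)) = 1 / (e * w)" for x
      using hsig by (simp_all add: mult_ac)
    \<comment> \<open>In this form the entries with q/f are the second halves of the theta functions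
      at p/w and p w.\<close>
    have y: "q / f / e * w = q / (f * e / w)" "q / f / e / w = q / (f * e * w)" by simp_all
    show ?thesis
      unfolding Let_def z w_def[symmetric] x y qpochs_inf_def kern_def qtheta_def
      by (simp add: mult_ac)
  qed
  \<comment> \<open>For p = f e the theta values of \<open>mass_eq\<close> are taken at p e = f e^2
    and p/e = f.\<close>
  have mass: "mass = 2 * pi * qtheta (f * e ^ 2) q * qtheta f q / qpoch_inf q q"
    using mass_eq by (simp add: power2_eq_square mult.assoc)
  have rhs: "mass * (qpoch_inf (a * b) q * qpoch_inf (a * c) q * qpoch_inf (b * c) q / (E a * E b * E c)) * (X * Y)
    = 2 * pi * qtheta f q * qtheta (f * e ^ 2) q * qpochs_inf [a * b, a * c, b * c] q
           / qpochs_inf [q, a * e, a / e, b * e, b / e, c * e, c / e] q * X * Y" for X Y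
    unfolding mass by (simp add: qpochs_inf_def E_def mult_ac)
  show ?thesis
    unfolding e_def[symmetric] Let_def[of e] integrand kern_phi32_integral[OF sm hd t] rhs
    by (rule refl)
qed

end
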